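(* Let $N\ge 1$ and let $\Omega=Q\cup P_1\cup\cdots\cup P_N\subset\mathbb{R}^d$, where $Q=(0,1)^d$, each $P_i$ is a full-dimensional convex polytope, and the sets $Q,P_1,\dots,P_N$ are pairwise non-overlapping. Suppose that for every $i=1,\dots,N$ and every facet $F$ of $P_i$, the unit outward normal vector of $F$ is not equal to $\pm e_j$ for any $j=1,\dots,d$. Then $\Omega$ is not a spectral set.
   Context: Sets are pairwise non-overlapping if any two distinct ones intersect in a set of Lebesgue measure zero. A convex polytope is full-dimensional if it has positive volume. A facet is a $(d-1)$-dimensional face of a polytope. $e_1,\dots,e_d$ are the standard unit vectors of $\mathbb{R}^d$. A bounded measurable set $\Omega\subset\mathbb{R}^d$ of finite positive Lebesgue measure is a spectral set if there is a countable set $\Lambda\subset\mathbb{R}^d$ such that $\{e^{2\pi i\langle\lambda,x\rangle}\}_{\lambda\in\Lambda}$ is an orthogonal basis of $L^2(\Omega)$. *)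

theory Defs
  imports "HOL-Analysis.Analysis"
begin

definition nonoverlapping :: "'a::euclidean_space set set \<Rightarrow> bool" where
  "nonoverlapping \<A> \<longleftrightarrow> pairwise (\<lambda>A B. negligible (A \<inter> B)) \<A>"

text \<open>The supporting half-space of a facet of a full-dimensional polytope is unique, so a facet
  of such a polytope has exactly one unit outward normal.\<close>

definition unit_outward_normal ::
    "'a::euclidean_space set \<Rightarrow> 'a set \<Rightarrow> 'a \<Rightarrow> bool" where
  "unit_outward_normal P F u \<longleftrightarrow>
     norm u = 1 \<and> (\<exists>b. P \<subseteq> {x. u \<bullet> x \<le> b} \<and> F = P \<inter> {x. u \<bullet> x = b})"

text \<open>Elements of the space are represented by functions, not by their classes modulo equality
  almost everywhere; accordingly \<open>L2_norm\<close> below is a seminorm, and a vector is nonzero when its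
  seminorm is nonzero.\<close>

definition L2_space :: "'a::euclidean_space set \<Rightarrow> ('a \<Rightarrow> complex) set" where
  "L2_space \<Omega> = {f \<in> borel_measurable (lebesgue_on \<Omega>).
     integrable (lebesgue_on \<Omega>) (\<lambda>x. (norm (f x))\<^sup>2)}"

definition L2_inner ::
    "'a::euclidean_space set \<Rightarrow> ('a \<Rightarrow> complex) \<Rightarrow> ('a \<Rightarrow> complex) \<Rightarrow> complex" where
  "L2_inner \<Omega> f g = (LINT x|lebesgue_on \<Omega>. f x * cnj (g x))"

definition L2_norm :: "'a::euclidean_space set \<Rightarrow> ('a \<Rightarrow> complex) \<Rightarrow> real" where
  "L2_norm \<Omega> f = sqrt (LINT x|lebesgue_on \<Omega>. (norm (f x))\<^sup>2)"

text \<open>An orthogonal basis in the Hilbert space sense: an orthogonal family of nonzero vectors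
  whose linear span is dense.\<close>

definition orthogonal_basis_L2 ::
    "'a::euclidean_space set \<Rightarrow> 'i set \<Rightarrow> ('i \<Rightarrow> 'a \<Rightarrow> complex) \<Rightarrow> bool" where
  "orthogonal_basis_L2 \<Omega> I e \<longleftrightarrow>
     (\<forall>i\<in>I. e i \<in> L2_space \<Omega> \<and> L2_norm \<Omega> (e i) \<noteq> 0) \<and>
     (\<forall>i\<in>I. \<forall>j\<in>I. i \<noteq> j \<longrightarrow> L2_inner \<Omega> (e i) (e j) = 0) \<and>
     (\<forall>f\<in>L2_space \<Omega>. \<forall>\<epsilon>>0. \<exists>S c. finite S \<and> S \<subseteq> I \<and>
        L2_norm \<Omega> (\<lambda>x. f x - (\<Sum>i\<in>S. c i * e i x)) < \<epsilon>)"

definition spectral_set :: "'a::euclidean_space set \<Rightarrow> bool" where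
  "spectral_set \<Omega> \<longleftrightarrow>
     bounded \<Omega> \<and> \<Omega> \<in> lmeasurable \<and> 0 < measure lebesgue \<Omega> \<and>
     (\<exists>\<Lambda>::'a set. countable \<Lambda> \<and>
        orthogonal_basis_L2 \<Omega> \<Lambda>
          (\<lambda>l x. exp (2 * complex_of_real pi * \<i> * complex_of_real (l \<bullet> x))))"

end

theory Submission
  imports Defs
begin

text \<open>Write \<open>ft X\<close> for the Fourier transform of the indicator of \<open>X\<close>, and let \<open>\<Lambda>\<close> be a spectrum of \<open>\<Omega>\<close>. The
  point is that the characters of \<open>\<Lambda>\<close> are orthogonal already on the cube \<open>Q\<close>; Parseval's identity in
  \<open>L\<^sup>2(\<Omega>)\<close> for a character restricted to \<open>Q\<close> then gives \<open>\<bar>\<Omega>\<bar> = 1\<close>, whereas \<open>\<bar>\<Omega>\<bar> = 1 + \<Sum> \<bar>P\<^sub>i\<bar> > 1\<close>.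

  For \<open>l \<noteq> m\<close> in \<open>\<Lambda>\<close> choose a coordinate \<open>j\<close> with \<open>l\<^sub>j \<noteq> m\<^sub>j\<close>. For every integer \<open>s\<close>, Parseval expresses
  \<open>\<bar>\<Omega>\<bar> ft Q (l - m)\<close> as the sum over \<open>\<nu> \<in> \<Lambda>\<close> of \<open>ft Q (l + s e\<^sub>j - \<nu>) * cnj (ft Q (m + s e\<^sub>j - \<nu>))\<close>. The
  terms with \<open>\<nu>\<close> far from \<open>s e\<^sub>j\<close> are negligible by Bessel's inequality. In the other, boundedly many
  terms put \<open>\<xi> = l - \<nu>\<close>. Then \<open>ft \<Omega> \<xi> = 0\<close>, and \<open>\<xi>\<^sub>j ft P\<^sub>i \<xi>\<close> is small because no facet of \<open>P\<^sub>i\<close> is normal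
  to \<open>e\<^sub>j\<close>; hence \<open>\<xi>\<^sub>j ft Q \<xi>\<close>, which equals \<open>(l + s e\<^sub>j - \<nu>)\<^sub>j ft Q (l + s e\<^sub>j - \<nu>)\<close>, is small.
  The same holds for \<open>m\<close>, and \<open>(l + s e\<^sub>j - \<nu>)\<^sub>j\<close> and \<open>(m + s e\<^sub>j - \<nu>)\<^sub>j\<close> are not both small, so as \<open>s\<close> grows each
  product tends to zero.\<close>

subsection \<open>Fourier transforms of indicators\<close>

definition ft :: "'a::euclidean_space set \<Rightarrow> 'a \<Rightarrow> complex" where
  "ft X \<xi> = integral X (\<lambda>x. cis (2 * pi * (\<xi> \<bullet> x)))"

lemma continuous_on_cis_inner: "continuous_on S (\<lambda>x. cis (2 * pi * (\<xi> \<bullet> x)))"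
  unfolding cis_conv_exp by (intro continuous_intros)

lemma borel_measurable_cis_inner [measurable]:
  "(\<lambda>x. cis (2 * pi * (\<xi> \<bullet> x))) \<in> borel_measurable borel"
  by (intro borel_measurable_continuous_onI continuous_on_cis_inner)

lemma cis_inner_measurable_lebesgue_on:
  "(\<lambda>x. cis (2 * pi * (\<xi> \<bullet> x))) \<in> borel_measurable (lebesgue_on X)"
  by (intro measurable_restrict_space1 measurable_completion) simp

lemma absolutely_integrable_cis_inner:
  assumes "X \<in> lmeasurable"
  shows "(\<lambda>x. cis (2 * pi * (\<xi> \<bullet> x))) absolutely_integrable_on X"
proof (rule measurable_bounded_by_integrable_imp_absolutely_integrable)
  show "(\<lambda>x. 1) integrable_on X" using assms by (rule integrable_on_const)
qed (use assms in \<open>auto intro: cis_inner_measurable_lebesgue_on\<close>)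

lemma integrable_cis_inner:
  assumes "X \<in> lmeasurable"
  shows "(\<lambda>x. cis (2 * pi * (\<xi> \<bullet> x))) integrable_on X"
  using absolutely_integrable_cis_inner[OF assms] set_lebesgue_integral_eq_integral(1) by blast

lemma has_integral_ft:
  "X \<in> lmeasurable \<Longrightarrow> ((\<lambda>x. cis (2 * pi * (\<xi> \<bullet> x))) has_integral ft X \<xi>) X"
  unfolding ft_def using integrable_cis_inner integrable_integral by blast

lemma ft_zero: "X \<in> lmeasurable \<Longrightarrow> ft X 0 = complex_of_real (measure lebesgue X)"
  unfolding ft_def using lmeasure_integral[of X] integral_linear[OF integrable_on_const bounded_linear_of_real, of X 1]
  by (simp add: o_def)

lemma norm_ft_le:
  assumes "X \<in> lmeasurable"
  shows "norm (ft X \<xi>) \<le> measure lebesgue X"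
proof -
  have "norm (ft X \<xi>) \<le> integral X (\<lambda>x. 1)"
    unfolding ft_def
    by (intro integral_norm_bound_integral integrable_cis_inner integrable_on_const assms) auto
  then show ?thesis using lmeasure_integral[OF assms] by simp
qed

text \<open>The substitution rule applied here is for boxes, so the integrand is extended by zero
  from the bounded set \<open>X\<close> to a box containing it.\<close>

lemma has_integral_translation:
  fixes f :: "'a::euclidean_space \<Rightarrow> 'b::banach"
  assumes "((\<lambda>x. f (v + x)) has_integral I) X" "bounded X"
  shows "(f has_integral I) ((+) v ` X)"
proof -
  obtain a b where ab: "X \<subseteq> cbox a b" using assms(2) bounded_subset_cbox_symmetric by blast
  let ?g = "\<lambda>x. if x \<in> X then f (v + x) else 0"
  have "(?g has_integral I) (cbox a b)"
    using assms(1) ab by (simp add: has_integral_restrict)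
  from has_integral_affinity[OF this, of 1 "-v"]
  have "((\<lambda>x. ?g (x + - v)) has_integral I) ((+) v ` cbox a b)"
    by (simp add: add.commute[of _ v] cong: if_cong)
  moreover have "(\<lambda>x. ?g (x + - v)) = (\<lambda>x. if x \<in> (+) v ` X then f x else 0)"
    by (auto simp: fun_eq_iff image_iff algebra_simps)
  ultimately have "((\<lambda>x. if x \<in> (+) v ` X then f x else 0) has_integral I) ((+) v ` cbox a b)" by simp
  then show ?thesis
    using ab by (subst (asm) has_integral_restrict) auto
qed

lemma ft_translation:
  assumes "X \<in> lmeasurable" "bounded X"
  shows "ft ((+) v ` X) \<xi> = cis (2 * pi * (\<xi> \<bullet> v)) * ft X \<xi>"
proof -
  have "((\<lambda>x. cis (2 * pi * (\<xi> \<bullet> (v + x)))) has_integral cis (2 * pi * (\<xi> \<bullet> v)) * ft X \<xi>) X"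
    using has_integral_mult_right[OF has_integral_ft[OF assms(1)], of "cis (2 * pi * (\<xi> \<bullet> v))"]
    by (simp add: cis_mult inner_add_right distrib_left)
  then have "((\<lambda>x. cis (2 * pi * (\<xi> \<bullet> x))) has_integral cis (2 * pi * (\<xi> \<bullet> v)) * ft X \<xi>) ((+) v ` X)"
    by (intro has_integral_translation) (use assms in auto)
  then show ?thesis unfolding ft_def by (rule integral_unique)
qed

lemma ft_Union:
  assumes "finite \<A>" "\<And>X. X \<in> \<A> \<Longrightarrow> X \<in> lmeasurable" "pairwise (\<lambda>X Y. negligible (X \<inter> Y)) \<A>"
  shows "ft (\<Union>\<A>) \<xi> = (\<Sum>X\<in>\<A>. ft X \<xi>)"
  unfolding ft_def
  by (intro integral_unique has_integral_Union assms)
    (auto simp: ft_def[symmetric] intro: has_integral_ft assms)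

lemma cis_diff_bound: "norm (cis a - cis b) \<le> \<bar>a - b\<bar>"
proof -
  have "norm (cis a - cis b) = norm (exp (\<i> * complex_of_real (a - b)) - 1)"
  proof -
    have "cis a - cis b = cis b * (cis (a - b) - 1)" by (simp add: right_diff_distrib cis_mult)
    then show ?thesis by (simp add: norm_mult flip: cis_conv_exp of_real_diff)
  qed
  also have "\<dots> \<le> \<bar>a - b\<bar>"
    using abs_sin_x_le_abs_x[of "(a-b)/2"] unfolding dist_exp_i_1 by simp
  finally show ?thesis .
qed

section \<open>Transforms of slabs of the unit cube\<close>

lemma ft_box: "ft (box a b) = ft (cbox a b)"
  unfolding ft_def by (simp add: integral_open_interval)

lemma ft_Un:
  assumes "X \<in> lmeasurable" "Y \<in> lmeasurable" "negligible (X \<inter> Y)"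
  shows "ft (X \<union> Y) \<xi> = ft X \<xi> + ft Y \<xi>"
  unfolding ft_def
  by (intro integral_unique has_integral_Un assms)
    (auto simp: ft_def[symmetric] intro: has_integral_ft assms)

text \<open>Only the \<open>j\<close>-th side of the cube varies. Cutting and translating in this
  direction shows how the cube's transform depends on \<open>\<xi> $ j\<close> without its product
  formula.\<close>

definition slab :: "'d \<Rightarrow> real \<Rightarrow> real \<Rightarrow> (real^'d) set" where
  "slab j s t = cbox (\<chi> k. if k = j then s else 0) (\<chi> k. if k = j then t else 1)"

lemma mem_slab: "x \<in> slab j s t \<longleftrightarrow> s \<le> x $ j \<and> x $ j \<le> t \<and> (\<forall>k. k \<noteq> j \<longrightarrow> 0 \<le> x $ k \<and> x $ k \<le> 1)"
  unfolding slab_def mem_box_cart by auto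

lemma slab_lmeasurable [simp]: "slab j s t \<in> lmeasurable" "bounded (slab j s t)"
  by (simp_all add: slab_def)

lemma ft_slab_split:
  assumes "s \<le> t" "t \<le> u"
  shows "ft (slab j s u) \<xi> = ft (slab j s t) \<xi> + ft (slab j t u) \<xi>"
proof -
  have "slab j s u = slab j s t \<union> slab j t u"
    using assms by (auto simp: mem_slab)
  moreover have "negligible (slab j s t \<inter> slab j t u)"
    by (rule negligible_subset[OF negligible_hyperplane[of "axis j 1" t]])
      (auto simp: mem_slab inner_axis')
  ultimately show ?thesis by (simp add: ft_Un)
qed

lemma ft_slab_shift:
  "ft (slab j (s + c) (t + c)) \<xi> = cis (2 * pi * c * \<xi> $ j) * ft (slab j s t) \<xi>"
proof -
  have "slab j (s + c) (t + c) = (+) (axis j c) ` slab j s t"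
  proof (intro equalityI subsetI)
    fix x assume x: "x \<in> slab j (s + c) (t + c)"
    then have "x - axis j c \<in> slab j s t" by (auto simp: mem_slab axis_def)
    then show "x \<in> (+) (axis j c) ` slab j s t" by (metis add.commute diff_add_cancel image_eqI)
  qed (auto simp: mem_slab axis_def)
  moreover have "2 * pi * (\<xi> \<bullet> axis j c) = 2 * pi * c * \<xi> $ j"
    by (simp add: inner_axis)
  ultimately show ?thesis by (simp only: ft_translation slab_lmeasurable)
qed

text \<open>Cut at \<open>t\<close>, the slab from \<open>0\<close> to \<open>1 + t\<close> is a
  slab of width \<open>t\<close> and a translate of the one of width 1; cut at \<open>1\<close>, it
  is the other way round. The two sums agree.\<close>

lemma ft_slab_eq:
  assumes "0 < t" "t < 1"
  shows "(1 - cis (2 * pi * t * \<xi> $ j)) * ft (slab j 0 1) \<xi> = (1 - cis (2 * pi * \<xi> $ j)) * ft (slab j 0 t) \<xi>"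
proof -
  have "ft (slab j 0 (1 + t)) \<xi> = ft (slab j 0 t) \<xi> + ft (slab j (0 + t) (1 + t)) \<xi>"
    using assms ft_slab_split[of 0 t "1 + t"] by simp
  moreover have "ft (slab j 0 (1 + t)) \<xi> = ft (slab j 0 1) \<xi> + ft (slab j (0 + 1) (t + 1)) \<xi>"
    using assms ft_slab_split[of 0 1 "1 + t"] by (simp add: add.commute)
  ultimately show ?thesis by (simp only: ft_slab_shift) (simp add: algebra_simps)
qed

lemma measure_slab:
  assumes "s \<le> t"
  shows "measure lebesgue (slab j s t) = t - s"
proof -
  have "slab j s t \<noteq> {}"
    using assms by (auto simp: slab_def interval_ne_empty_cart)
  then have "measure lebesgue (slab j s t) = (\<Prod>k\<in>UNIV. if k = j then t - s else 1)"
  proof -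
    have "measure lebesgue (slab j s t) = measure lborel (slab j s t)"
      by (simp add: slab_def)
    also have "\<dots> = (\<Prod>k\<in>UNIV. if k = j then t - s else 1)"
      using \<open>slab j s t \<noteq> {}\<close> unfolding slab_def
      by (subst content_cbox_cart) (assumption, intro prod.cong, auto)
    finally show ?thesis .
  qed
  then show ?thesis by simp
qed

text \<open>One factor \<open>t\<close> bounds \<open>x $ j\<close> in the phase difference, the
  other is the volume of the slab. Being quadratic, the bound still tends to zero after division by
  \<open>t\<close>.\<close>

lemma ft_slab_shift_le:
  assumes "0 \<le> t" "t \<le> 1"
  shows "norm (ft (slab j 0 t) (\<xi> + axis j c) - ft (slab j 0 t) \<xi>) \<le> 2 * pi * \<bar>c\<bar> * t\<^sup>2"
proof -
  have "norm (integral (slab j 0 t) (\<lambda>x. cis (2 * pi * ((\<xi> + axis j c) \<bullet> x)) - cis (2 * pi * (\<xi> \<bullet> x))))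
      \<le> integral (slab j 0 t) (\<lambda>x. 2 * pi * \<bar>c\<bar> * t)"
  proof (intro integral_norm_bound_integral integrable_diff integrable_cis_inner integrable_on_const)
    fix x assume x: "x \<in> slab j 0 t"
    have "norm (cis (2 * pi * ((\<xi> + axis j c) \<bullet> x)) - cis (2 * pi * (\<xi> \<bullet> x)))
       \<le> \<bar>2 * pi * ((\<xi> + axis j c) \<bullet> x) - 2 * pi * (\<xi> \<bullet> x)\<bar>"
      by (rule cis_diff_bound)
    also have "\<dots> = 2 * pi * \<bar>c\<bar> * \<bar>x $ j\<bar>"
      by (simp add: inner_axis' inner_add_left distrib_left abs_mult)
    also have "\<dots> \<le> 2 * pi * \<bar>c\<bar> * t"
      using x by (intro mult_left_mono) (auto simp: mem_slab)
    finally show "norm (cis (2 * pi * ((\<xi> + axis j c) \<bullet> x)) - cis (2 * pi * (\<xi> \<bullet> x))) \<le> 2 * pi * \<bar>c\<bar> * t" .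
  qed auto
  also have "\<dots> = 2 * pi * \<bar>c\<bar> * t * measure lebesgue (slab j 0 t)"
    using integral_mult_right[of "slab j 0 t" "2 * pi * \<bar>c\<bar> * t" "\<lambda>_. 1"]
    by (simp add: lmeasure_integral)
  finally show ?thesis
    using assms by (simp add: ft_def integral_diff integrable_cis_inner measure_slab power2_eq_square)
qed

lemma tendsto_difference_quotient_cis: 
  "((\<lambda>t. (1 - cis (2 * pi * t * a)) / complex_of_real t) \<longlongrightarrow> - \<i> * 2 * pi * a) (at_right 0)"
proof -
  have "((\<lambda>z. exp (\<i> * 2 * pi * a * z)) has_field_derivative (\<i> * 2 * pi * a)) (at 0)"
    by (auto intro!: derivative_eq_intros)
  then have "((\<lambda>z. (exp (\<i> * 2 * pi * a * z) - 1) / z) \<longlongrightarrow> \<i> * 2 * pi * a) (at 0)"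
    by (simp add: has_field_derivative_iff)
  moreover have "filterlim complex_of_real (at 0) (at_right 0)"
    by (auto simp: filterlim_at eventually_at_filter intro!: tendsto_eq_intros)
  ultimately have "((\<lambda>t. (exp (\<i> * 2 * pi * a * of_real t) - 1) / of_real t) \<longlongrightarrow> \<i> * 2 * pi * a) (at_right 0)"
    by (rule filterlim_compose)
  then have "((\<lambda>t. - ((exp (\<i> * 2 * pi * a * of_real t) - 1) / of_real t)) \<longlongrightarrow> - (\<i> * 2 * pi * a)) (at_right 0)"
    by (rule tendsto_minus)
  moreover have "- ((exp (\<i> * 2 * pi * a * of_real t) - 1) / of_real t) = (1 - cis (2 * pi * t * a)) / complex_of_real t" for t
    unfolding minus_divide_left minus_diff_eq cis_conv_exp by (simp add: mult_ac)
  ultimately show ?thesis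
    by simp
qed

text \<open>Divided by \<open>t\<close>, the left side of \<open>ft_slab_eq\<close> tends to a
  constant times \<open>\<xi> $ j\<close> times the transform as \<open>t\<close> tends to zero. On
  the right, an integer shift preserves the factor \<open>1 - cis (2 * pi * \<xi> $ j)\<close> and
  changes the quotient by \<open>O(t)\<close> only. The identity carries smallness from a distant
  frequency back to a near one.\<close>

lemma ft_slab_int_shift:
  assumes "s \<in> \<int>"
  shows "complex_of_real (\<xi> $ j + s) * ft (slab j 0 1) (\<xi> + axis j s) = \<xi> $ j * ft (slab j 0 1) \<xi>"
proof -
  let ?F = "ft (slab j 0 1)" and ?f = "\<lambda>t. ft (slab j 0 t)" and ?\<xi> = "\<xi> + axis j s"
  \<comment> \<open>The difference of the left sides of \<open>ft_slab_eq\<close>, divided by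
    \<open>t\<close>, at the shifted and the original frequency; its limit is found in two
    ways.\<close>
  define D where "D t = (1 - cis (2 * pi * t * ?\<xi> $ j)) / complex_of_real t * ?F ?\<xi>
      - (1 - cis (2 * pi * t * \<xi> $ j)) / complex_of_real t * ?F \<xi>" for t
  have per: "cis (2 * pi * ?\<xi> $ j) = cis (2 * pi * \<xi> $ j)"
    using assms by (simp add: axis_def distrib_left flip: cis_mult)
  have D: "norm (D t) \<le> 4 * pi * \<bar>s\<bar> * t" if t: "0 < t" "t < 1" for t
  proof -
    have "D t = (1 - cis (2 * pi * \<xi> $ j)) * (?f t ?\<xi> - ?f t \<xi>) / t"
      unfolding D_def times_divide_eq_left ft_slab_eq[OF t] per by (simp add: diff_divide_distrib right_diff_distrib)
    then have "norm (D t) = norm (1 - cis (2 * pi * \<xi> $ j)) * norm (?f t ?\<xi> - ?f t \<xi>) / t"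
      using t by (simp add: norm_mult norm_divide)
    also have "\<dots> \<le> 2 * (2 * pi * \<bar>s\<bar> * t\<^sup>2) / t"
      using t ft_slab_shift_le[of t j \<xi> s] norm_triangle_ineq4[of 1 "cis (2 * pi * \<xi> $ j)"]
      by (intro divide_right_mono mult_mono) auto
    finally show ?thesis using t by (simp add: power2_eq_square)
  qed
  have "(D \<longlongrightarrow> 0) (at_right 0)"
  proof (rule tendsto_norm_zero_cancel, rule tendsto_sandwich[where f="\<lambda>_. 0" and h="\<lambda>t. 4 * pi * \<bar>s\<bar> * t"])
    show "\<forall>\<^sub>F t in at_right 0. norm (D t) \<le> 4 * pi * \<bar>s\<bar> * t"
      using D by (auto simp: eventually_at_right_field intro!: exI[of _ 1])
    show "((\<lambda>t. 4 * pi * \<bar>s\<bar> * t) \<longlongrightarrow> 0) (at_right 0)"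
      by (auto intro!: tendsto_eq_intros)
  qed auto
  moreover have "(D \<longlongrightarrow> (- \<i> * 2 * pi * ?\<xi> $ j) * ?F ?\<xi> - (- \<i> * 2 * pi * \<xi> $ j) * ?F \<xi>) (at_right 0)"
    unfolding D_def by (intro tendsto_intros tendsto_difference_quotient_cis)
  ultimately have "(- \<i> * 2 * pi * ?\<xi> $ j) * ?F ?\<xi> - (- \<i> * 2 * pi * \<xi> $ j) * ?F \<xi> = 0"
    by (intro tendsto_unique[of "at_right 0" D]) simp_all
  then have "(- \<i> * 2 * pi) * (?\<xi> $ j * ?F ?\<xi> - \<xi> $ j * ?F \<xi>) = 0"
    by (simp add: algebra_simps)
  then show ?thesis by (simp add: axis_def)
qed

subsection \<open>Decay of the transform of a polytope\<close>

lemma dual_vector: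
  fixes a b :: "'a::euclidean_space"
  assumes "b \<noteq> 0" "\<And>c. a \<noteq> c *\<^sub>R b"
  obtains u where "a \<bullet> u = 1" "b \<bullet> u = 0"
proof -
  \<comment> \<open>The component of \<open>a\<close> orthogonal to \<open>b\<close>, nonzero
    because \<open>a\<close> is not a multiple of \<open>b\<close>; it only has to be
    rescaled.\<close>
  define w where "w = a - ((a \<bullet> b) / (b \<bullet> b)) *\<^sub>R b"
  have b: "b \<bullet> w = 0" using assms(1) by (simp add: w_def inner_diff_right inner_commute)
  have w: "w \<noteq> 0" using assms(2) by (simp add: w_def)
  have "w \<bullet> w = a \<bullet> w" using b by (subst (1) w_def) (simp add: inner_diff_left)
  with w have "a \<bullet> w \<noteq> 0" by (metis inner_eq_zero_iff)
  then show ?thesis using that[of "(1 / (a \<bullet> w)) *\<^sub>R w"] b by simp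
qed

lemma lmeasurable_two_slabs:
  fixes a b :: "'a::euclidean_space"
  shows "{x \<in> cball 0 R. \<bar>a \<bullet> x - \<alpha>\<bar> \<le> \<delta> \<and> \<bar>b \<bullet> x - \<beta>\<bar> \<le> \<delta>} \<in> lmeasurable"
proof (rule lmeasurable_compact)
  have "{x \<in> cball 0 R. \<bar>a \<bullet> x - \<alpha>\<bar> \<le> \<delta> \<and> \<bar>b \<bullet> x - \<beta>\<bar> \<le> \<delta>} =
      cball 0 R \<inter> ({x. \<bar>a \<bullet> x - \<alpha>\<bar> \<le> \<delta>} \<inter> {x. \<bar>b \<bullet> x - \<beta>\<bar> \<le> \<delta>})" by auto
  moreover have "closed ({x. \<bar>a \<bullet> x - \<alpha>\<bar> \<le> \<delta>} \<inter> {x. \<bar>b \<bullet> x - \<beta>\<bar> \<le> \<delta>})"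
    by (intro closed_Int closed_Collect_le continuous_intros)
  ultimately show "compact {x \<in> cball 0 R. \<bar>a \<bullet> x - \<alpha>\<bar> \<le> \<delta> \<and> \<bar>b \<bullet> x - \<beta>\<bar> \<le> \<delta>}"
    by (simp add: compact_Int_closed)
qed

text \<open>A packing argument: translations by multiples of \<open>3 * \<delta>\<close> along two
  dual vectors give about \<open>(1 / (3 * \<delta>))\<^sup>2\<close> copies of the region. They are
  disjoint because each functional varies by at most \<open>2 * \<delta>\<close> on the region, and
  they lie in a ball independent of \<open>\<delta>\<close>.\<close>

lemma measure_two_slabs_transversal:
  fixes a b :: "'a::euclidean_space"
  assumes a: "a \<noteq> 0" "\<And>c. b \<noteq> c *\<^sub>R a" and b: "b \<noteq> 0" "\<And>c. a \<noteq> c *\<^sub>R b"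
  obtains C where "\<And>\<delta>. 0 < \<delta> \<Longrightarrow> \<delta> \<le> 1/3 \<Longrightarrow>
    measure lebesgue {x \<in> cball 0 R. \<bar>a \<bullet> x - \<alpha>\<bar> \<le> \<delta> \<and> \<bar>b \<bullet> x - \<beta>\<bar> \<le> \<delta>} \<le> C * \<delta>\<^sup>2"
proof -
  obtain u where u: "a \<bullet> u = 1" "b \<bullet> u = 0" using dual_vector[OF b] .
  obtain w where w: "b \<bullet> w = 1" "a \<bullet> w = 0" using dual_vector[OF a] .
  define M where "M = measure lebesgue (cball (0::'a) (R + 2 * (norm u + norm w)))"
  show ?thesis
  proof (rule that[of "9 * M"])
    fix \<delta> :: real assume \<delta>: "0 < \<delta>" "\<delta> \<le> 1/3"
    define Z where "Z = {x \<in> cball 0 R. \<bar>a \<bullet> x - \<alpha>\<bar> \<le> \<delta> \<and> \<bar>b \<bullet> x - \<beta>\<bar> \<le> \<delta>}"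
    have Z: "Z \<in> lmeasurable" unfolding Z_def by (rule lmeasurable_two_slabs)
    \<comment> \<open>The product \<open>3 * \<delta> * K\<close> then lies between 1 and 2: the
      lower bound provides enough copies, the upper one keeps them in the ball.\<close>
    define K where "K = nat \<lceil>1 / (3 * \<delta>)\<rceil>"
    have K: "1 / (3 * \<delta>) \<le> K" "K \<le> 1 / (3 * \<delta>) + 1"
      using \<delta> unfolding K_def by (auto simp: of_nat_ceiling)
    have K3: "3 * \<delta> * K \<le> 2" "1 \<le> 3 * \<delta> * K" using K \<delta> by (auto simp: field_simps)
    define s where "s = (\<lambda>(k::nat, l::nat). (3 * \<delta> * k) *\<^sub>R u + (3 * \<delta> * l) *\<^sub>R w)"
    let ?J = "{..<K} \<times> {..<K}"
    have sub: "(\<Union>p\<in>?J. (+) (s p) ` Z) \<subseteq> cball 0 (R + 2 * (norm u + norm w))"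
    proof
      fix y assume "y \<in> (\<Union>p\<in>?J. (+) (s p) ` Z)"
      then obtain k l x where kl: "k < K" "l < K" and x: "norm x \<le> R" and y: "y = s (k, l) + x"
        by (auto simp: Z_def)
      have "3 * \<delta> * real k \<le> 2" "3 * \<delta> * real l \<le> 2"
        using kl \<delta> K3(1) by (auto intro!: order.trans[OF mult_left_mono K3(1)])
      then have "norm (s (k, l)) \<le> 2 * norm u + 2 * norm w"
        using \<delta> unfolding s_def prod.case
        by (intro norm_triangle_le add_mono) (auto intro!: mult_right_mono)
      then show "y \<in> cball 0 (R + 2 * (norm u + norm w))"
        using x norm_triangle_ineq[of "s (k, l)" x] by (simp add: y distrib_left)
    qed
    have disj: "disjnt ((+) (s p) ` Z) ((+) (s q) ` Z)" if "p \<noteq> q" for p q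
    proof (rule ccontr)
      assume "\<not> disjnt ((+) (s p) ` Z) ((+) (s q) ` Z)"
      then obtain x y where xy: "x \<in> Z" "y \<in> Z" "s p + x = s q + y"
        unfolding disjnt_def by auto
      obtain k l k' l' where pq: "p = (k, l)" "q = (k', l')" by fastforce
      have "a \<bullet> (s p + x) = a \<bullet> (s q + y)" "b \<bullet> (s p + x) = b \<bullet> (s q + y)" using xy by auto
      then have "3 * \<delta> * (real k - real k') = a \<bullet> y - a \<bullet> x" "3 * \<delta> * (real l - real l') = b \<bullet> y - b \<bullet> x"
        by (auto simp: pq s_def inner_add_right u w algebra_simps)
      moreover have "\<bar>a \<bullet> y - a \<bullet> x\<bar> \<le> 2 * \<delta>" "\<bar>b \<bullet> y - b \<bullet> x\<bar> \<le> 2 * \<delta>"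
        using xy unfolding Z_def by auto
      moreover have "\<bar>3 * \<delta> * t\<bar> = 3 * \<delta> * \<bar>t\<bar>" for t using \<delta> by (simp add: abs_mult)
      ultimately have "3 * \<delta> * \<bar>real k - real k'\<bar> \<le> 2 * \<delta>" "3 * \<delta> * \<bar>real l - real l'\<bar> \<le> 2 * \<delta>"
        by metis+
      then have "\<bar>real k - real k'\<bar> < 1" "\<bar>real l - real l'\<bar> < 1" using \<delta> by auto
      then have "k = k'" "l = l'" by linarith+
      then show False using that pq by simp
    qed
    have "measure lebesgue (\<Union>p\<in>?J. (+) (s p) ` Z) = (\<Sum>p\<in>?J. measure lebesgue ((+) (s p) ` Z))"
    proof (rule measure_negligible_finite_Union_image)
      show "pairwise (\<lambda>p q. negligible ((+) (s p) ` Z \<inter> (+) (s q) ` Z)) ?J"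
        using disj by (auto simp: pairwise_def disjnt_def)
    qed (use Z in \<open>auto intro: measurable_translation\<close>)
    also have "\<dots> = (real K)\<^sup>2 * measure lebesgue Z"
      by (simp add: measure_translation power2_eq_square)
    finally have eq: "measure lebesgue (\<Union>p\<in>?J. (+) (s p) ` Z) = (real K)\<^sup>2 * measure lebesgue Z" .
    have "(\<Union>p\<in>?J. (+) (s p) ` Z) \<in> lmeasurable"
      using Z by (intro fmeasurable.finite_UN measurable_translation) auto
    then have "(real K)\<^sup>2 * measure lebesgue Z \<le> M"
      unfolding M_def eq[symmetric] by (intro measure_mono_fmeasurable[OF sub] fmeasurableD) auto
    then have "(3 * \<delta> * K)\<^sup>2 * measure lebesgue Z \<le> 9 * M * \<delta>\<^sup>2"
      using mult_left_mono[of "(real K)\<^sup>2 * measure lebesgue Z" M "9 * \<delta>\<^sup>2"]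
      by (simp add: power_mult_distrib mult_ac)
    moreover have "1 * measure lebesgue Z \<le> (3 * \<delta> * K)\<^sup>2 * measure lebesgue Z"
      using K3(2) by (intro mult_right_mono) (auto simp: one_le_power)
    ultimately show "measure lebesgue {x \<in> cball 0 R. \<bar>a \<bullet> x - \<alpha>\<bar> \<le> \<delta> \<and> \<bar>b \<bullet> x - \<beta>\<bar> \<le> \<delta>} \<le> 9 * M * \<delta>\<^sup>2"
      unfolding Z_def by linarith
  qed
qed

text \<open>Hyperplanes that are parallel and distinct have disjoint thin neighbourhoods; all others
  are covered by the transversal case.\<close>

lemma measure_two_slabs:
  fixes a b :: "'a::euclidean_space"
  assumes "a \<noteq> 0" "b \<noteq> 0" and ne: "\<And>c. \<not> (b = c *\<^sub>R a \<and> \<beta> = c * \<alpha>)"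
  obtains C D where "0 < D" "\<And>\<delta>. 0 < \<delta> \<Longrightarrow> \<delta> \<le> D \<Longrightarrow>
    measure lebesgue {x \<in> cball 0 R. \<bar>a \<bullet> x - \<alpha>\<bar> \<le> \<delta> \<and> \<bar>b \<bullet> x - \<beta>\<bar> \<le> \<delta>} \<le> C * \<delta>\<^sup>2"
proof (cases "\<exists>c. b = c *\<^sub>R a")
  case True
  then obtain c where c: "b = c *\<^sub>R a" by blast
  with ne have "\<beta> \<noteq> c * \<alpha>" by blast
  \<comment> \<open>A common point of the two slabs forces \<open>\<bar>\<beta> - c * \<alpha>\<bar>
    \<le> (1 + \<bar>c\<bar>) * \<delta>\<close>, and \<open>\<delta> \<le> D\<close> makes the
    right side at most half of the left.\<close>
  define D where "D = \<bar>\<beta> - c * \<alpha>\<bar> / (2 * (1 + \<bar>c\<bar>))"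
  have D: "D > 0" using \<open>\<beta> \<noteq> c * \<alpha>\<close> by (simp add: D_def zero_less_divide_iff)
  show ?thesis
  proof (rule that[of D 0])
    fix \<delta> assume \<delta>: "0 < \<delta>" "\<delta> \<le> D"
    have "False" if "\<bar>a \<bullet> x - \<alpha>\<bar> \<le> \<delta>" "\<bar>b \<bullet> x - \<beta>\<bar> \<le> \<delta>" for x
    proof -
      have "\<beta> - c * \<alpha> = c * (a \<bullet> x - \<alpha>) - (b \<bullet> x - \<beta>)" by (simp add: c algebra_simps)
      then have "\<bar>\<beta> - c * \<alpha>\<bar> \<le> \<bar>c\<bar> * \<bar>a \<bullet> x - \<alpha>\<bar> + \<bar>b \<bullet> x - \<beta>\<bar>"
        by (metis abs_mult abs_triangle_ineq4)
      also have "\<dots> \<le> \<bar>c\<bar> * \<delta> + \<delta>" using that by (intro add_mono mult_left_mono) auto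
      also have "\<dots> = \<delta> * (1 + \<bar>c\<bar>)" by (simp add: algebra_simps)
      also have "\<dots> \<le> D * (1 + \<bar>c\<bar>)" using \<delta> by (intro mult_right_mono) auto
      also have "\<dots> = \<bar>\<beta> - c * \<alpha>\<bar> / 2" by (simp add: D_def field_simps)
      finally show False using \<open>\<beta> \<noteq> c * \<alpha>\<close> by auto
    qed
    then have *: "{x \<in> cball 0 R. \<bar>a \<bullet> x - \<alpha>\<bar> \<le> \<delta> \<and> \<bar>b \<bullet> x - \<beta>\<bar> \<le> \<delta>} = {}" by blast
    show "measure lebesgue {x \<in> cball 0 R. \<bar>a \<bullet> x - \<alpha>\<bar> \<le> \<delta> \<and> \<bar>b \<bullet> x - \<beta>\<bar> \<le> \<delta>} \<le> 0 * \<delta>\<^sup>2"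
      unfolding * by simp
  qed (use D in auto)
next
  case False
  then have na: "b \<noteq> c *\<^sub>R a" for c by blast
  have nb: "a \<noteq> c *\<^sub>R b" for c
  proof
    assume "a = c *\<^sub>R b"
    then have "b = (1/c) *\<^sub>R a" using assms(1) by auto
    with False show False by blast
  qed
  obtain C where "\<And>\<delta>. 0 < \<delta> \<Longrightarrow> \<delta> \<le> 1/3 \<Longrightarrow>
    measure lebesgue {x \<in> cball 0 R. \<bar>a \<bullet> x - \<alpha>\<bar> \<le> \<delta> \<and> \<bar>b \<bullet> x - \<beta>\<bar> \<le> \<delta>} \<le> C * \<delta>\<^sup>2"
    by (rule measure_two_slabs_transversal[OF assms(1) na assms(2) nb]) blast
  then show ?thesis using that[of "1/3" C] by auto
qed

lemma measure_two_slabs_Union: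
  fixes a :: "'i \<Rightarrow> 'a::euclidean_space"
  assumes "finite I" "\<And>i. i \<in> I \<Longrightarrow> a i \<noteq> 0"
    and ne: "\<And>i k c. i \<in> I \<Longrightarrow> k \<in> I \<Longrightarrow> i \<noteq> k \<Longrightarrow> \<not> (a k = c *\<^sub>R a i \<and> b k = c * b i)"
  obtains C D where "0 < D" "0 \<le> C" "\<And>\<delta>. 0 < \<delta> \<Longrightarrow> \<delta> \<le> D \<Longrightarrow>
    measure lebesgue {x \<in> cball 0 R. \<exists>i\<in>I. \<exists>k\<in>I. i \<noteq> k \<and> \<bar>a i \<bullet> x - b i\<bar> \<le> \<delta> \<and> \<bar>a k \<bullet> x - b k\<bar> \<le> \<delta>} \<le> C * \<delta>\<^sup>2"
    "\<And>\<delta>. {x \<in> cball 0 R. \<exists>i\<in>I. \<exists>k\<in>I. i \<noteq> k \<and> \<bar>a i \<bullet> x - b i\<bar> \<le> \<delta> \<and> \<bar>a k \<bullet> x - b k\<bar> \<le> \<delta>} \<in> lmeasurable"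
proof -
  let ?S = "\<lambda>\<delta> (i, k). {x \<in> cball 0 R. \<bar>a i \<bullet> x - b i\<bar> \<le> \<delta> \<and> \<bar>a k \<bullet> x - b k\<bar> \<le> \<delta>}"
  define J where "J = {(i, k). i \<in> I \<and> k \<in> I \<and> i \<noteq> k}"
  have fin: "finite J" unfolding J_def by (rule finite_subset[of _ "I \<times> I"]) (use assms(1) in auto)
  define m where "m \<delta> p = measure lebesgue (?S \<delta> p)" for \<delta> p
  have "\<exists>C D. 0 < D \<and> (\<forall>\<delta>. 0 < \<delta> \<longrightarrow> \<delta> \<le> D \<longrightarrow> m \<delta> p \<le> C * \<delta>\<^sup>2)" if pJ: "p \<in> J" for p
  proof -
    obtain i k where p: "p = (i, k)" and ik: "i \<in> I" "k \<in> I" "i \<noteq> k" using pJ unfolding J_def by auto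
    show ?thesis
      unfolding m_def p prod.case
      by (rule measure_two_slabs[OF assms(2)[OF ik(1)] assms(2)[OF ik(2)] ne[OF ik], of R]) blast
  qed
  then obtain C D where "\<And>p. p \<in> J \<Longrightarrow> 0 < D p \<and> (\<forall>\<delta>. 0 < \<delta> \<longrightarrow> \<delta> \<le> D p \<longrightarrow> m \<delta> p \<le> C p * \<delta>\<^sup>2)"
    by metis
  then have CD: "\<And>p. p \<in> J \<Longrightarrow> 0 < D p"
    "\<And>p \<delta>. p \<in> J \<Longrightarrow> 0 < \<delta> \<Longrightarrow> \<delta> \<le> D p \<Longrightarrow> m \<delta> p \<le> C p * \<delta>\<^sup>2"
    by blast+
  have eq: "{x \<in> cball 0 R. \<exists>i\<in>I. \<exists>k\<in>I. i \<noteq> k \<and> \<bar>a i \<bullet> x - b i\<bar> \<le> \<delta> \<and> \<bar>a k \<bullet> x - b k\<bar> \<le> \<delta>} = (\<Union>p\<in>J. ?S \<delta> p)" for \<delta>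
    unfolding J_def by auto
  have lm: "?S \<delta> p \<in> lmeasurable" for \<delta> p by (cases p) (simp only: prod.case lmeasurable_two_slabs)
  show ?thesis
  \<comment> \<open>The inserted 1 gives \<open>Min\<close> a value when there is no pair of
    distinct constraints.\<close>
  proof (rule that[of "Min (insert 1 (D ` J))" "\<Sum>p\<in>J. \<bar>C p\<bar>"])
    show "0 < Min (insert 1 (D ` J))" using fin CD(1) by (subst Min_gr_iff) auto
    show "0 \<le> (\<Sum>p\<in>J. \<bar>C p\<bar>)" by (simp add: sum_nonneg)
    fix \<delta> :: real
    show "{x \<in> cball 0 R. \<exists>i\<in>I. \<exists>k\<in>I. i \<noteq> k \<and> \<bar>a i \<bullet> x - b i\<bar> \<le> \<delta> \<and> \<bar>a k \<bullet> x - b k\<bar> \<le> \<delta>} \<in> lmeasurable"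
      unfolding eq using fin lm by (intro fmeasurable.finite_UN) auto
    assume \<delta>: "0 < \<delta>" "\<delta> \<le> Min (insert 1 (D ` J))"
    then have "\<And>p. p \<in> J \<Longrightarrow> \<delta> \<le> D p" using fin by (subst (asm) Min_ge_iff) auto
    then have "m \<delta> p \<le> \<bar>C p\<bar> * \<delta>\<^sup>2" if "p \<in> J" for p
      using CD(2)[OF that \<delta>(1)] that by (meson abs_ge_self mult_right_mono order_trans zero_le_power2)
    then have "(\<Sum>p\<in>J. m \<delta> p) \<le> (\<Sum>p\<in>J. \<bar>C p\<bar>) * \<delta>\<^sup>2"
      unfolding sum_distrib_right by (rule sum_mono)
    then show "measure lebesgue {x \<in> cball 0 R. \<exists>i\<in>I. \<exists>k\<in>I. i \<noteq> k \<and> \<bar>a i \<bullet> x - b i\<bar> \<le> \<delta> \<and> \<bar>a k \<bullet> x - b k\<bar> \<le> \<delta>} \<le> (\<Sum>p\<in>J. \<bar>C p\<bar>) * \<delta>\<^sup>2"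
      unfolding eq using measure_UNION_le[OF fin, of "?S \<delta>" lebesgue] lm
      unfolding m_def by (meson fmeasurableD order_trans)
  qed
qed

text \<open>Subsets that avoid \<open>i\<close> are paired with their extensions by
  \<open>i\<close>; the two terms of each pair have opposite signs.\<close>

lemma sum_Pow_alternating_eq_0:
  fixes g :: "'i set \<Rightarrow> complex"
  assumes "finite I" "i \<in> I" "\<And>J. J \<subseteq> I - {i} \<Longrightarrow> g (insert i J) = g J"
  shows "(\<Sum>J\<in>Pow I. (-1) ^ card J * g J) = 0"
proof -
  define f where "f J = (-1) ^ card J * g J" for J
  have f: "f (insert i J) = - f J" if "J \<subseteq> I - {i}" for J
  proof -
    have "finite J" "i \<notin> J" using that assms(1) finite_subset by auto
    then show ?thesis using assms(3)[OF that] by (simp add: f_def)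
  qed
  have "sum f (Pow I) = sum f (Pow (insert i (I - {i})))"
    using assms(2) by (simp add: insert_absorb)
  also have "\<dots> = sum f (Pow (I - {i})) + sum f (insert i ` Pow (I - {i}))"
    unfolding Pow_insert using assms(1) by (intro sum.union_disjoint) auto
  also have "sum f (insert i ` Pow (I - {i})) = (\<Sum>J\<in>Pow (I - {i}). f (insert i J))"
    by (subst sum.reindex) (auto simp: inj_on_def o_def)
  also have "\<dots> = (\<Sum>J\<in>Pow (I - {i}). - f J)"
    by (intro sum.cong) (auto simp: f)
  finally show ?thesis by (simp add: sum_negf f_def)
qed

text \<open>Translating the polytope by a vector parallel to the \<open>i\<close>-th facet and antiperiodic for the
  character changes the sign of the transform. The alternating sum over all subsets of such
  translations therefore reproduces \<open>2 ^ card I\<close> times the transform, while the corresponding sum of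
  indicators vanishes wherever at most one constraint is nearly tight.\<close>
lemma norm_ft_halfspaces_le:
  fixes a v :: "'i \<Rightarrow> 'a::euclidean_space"
  defines "w \<equiv> \<lambda>J. \<Sum>i\<in>J. v i"
  assumes P: "P = {x. \<forall>i\<in>I. a i \<bullet> x \<le> b i}" "P \<subseteq> cball 0 R" and I: "finite I" "I \<noteq> {}"
    and av: "\<And>i. i \<in> I \<Longrightarrow> a i \<bullet> v i = 0"
    and anti: "\<And>i. i \<in> I \<Longrightarrow> \<xi> \<bullet> v i = 1 / 2"
    and small: "\<And>i J. i \<in> I \<Longrightarrow> J \<subseteq> I \<Longrightarrow> \<bar>a i \<bullet> w J\<bar> \<le> \<delta>"
    and wR: "\<And>J. J \<subseteq> I \<Longrightarrow> norm (w J) \<le> 1"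
    and B: "B = {x \<in> cball 0 (R + 1). \<exists>i\<in>I. \<exists>k\<in>I. i \<noteq> k \<and> \<bar>a i \<bullet> x - b i\<bar> \<le> \<delta> \<and> \<bar>a k \<bullet> x - b k\<bar> \<le> \<delta>}"
    "B \<in> lmeasurable"
  shows "norm (ft P \<xi>) \<le> measure lebesgue B"
proof -
  let ?m = "card I" and ?e = "\<lambda>x. cis (2 * pi * (\<xi> \<bullet> x))"
  define PJ where "PJ J = (+) (- w J) ` P" for J
  have mem: "x \<in> PJ J \<longleftrightarrow> x + w J \<in> P" for x J
    unfolding PJ_def by (auto simp: image_iff) (metis add.commute add_minus_cancel uminus_add_conv_diff)
  have "P = (\<Inter>i\<in>I. {x. a i \<bullet> x \<le> b i})" using P(1) by auto
  then have "closed P" by (auto intro!: closed_INT closed_halfspace_le)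
  moreover have "bounded P" using P(2) bounded_subset bounded_cball by blast
  ultimately have Pm: "P \<in> lmeasurable" by (simp add: lmeasurable_compact compact_eq_bounded_closed)
  have PJm: "PJ J \<in> lmeasurable" for J unfolding PJ_def by (intro measurable_translation Pm)
  have ftJ: "ft (PJ J) \<xi> = (-1) ^ card J * ft P \<xi>" if "J \<subseteq> I" for J
  proof -
    have "\<xi> \<bullet> w J = (\<Sum>i\<in>J. 1 / 2)"
      unfolding w_def inner_sum_right using that anti by (intro sum.cong) auto
    then have "2 * pi * (\<xi> \<bullet> - w J) = - (real (card J) * pi)" by simp
    then have "cis (2 * pi * (\<xi> \<bullet> - w J)) = cnj (cis (real (card J) * pi))"
      by (simp only: cis_cnj)
    also have "cis (real (card J) * pi) = (-1) ^ card J" by (simp flip: Complex.DeMoivre)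
    finally show ?thesis unfolding PJ_def ft_translation[OF Pm \<open>bounded P\<close>] by simp
  qed
  define G where "G x = (\<Sum>J\<in>Pow I. (-1) ^ card J * (if x \<in> PJ J then ?e x else 0))" for x
  have "(G has_integral (\<Sum>J\<in>Pow I. (-1) ^ card J * ft (PJ J) \<xi>)) UNIV"
    unfolding G_def
    by (intro has_integral_sum has_integral_mult_right)
      (use I in \<open>auto simp: has_integral_restrict_UNIV intro!: has_integral_ft PJm\<close>)
  also have "(\<Sum>J\<in>Pow I. (-1) ^ card J * ft (PJ J) \<xi>) = (\<Sum>J\<in>Pow I. ft P \<xi>)"
    by (intro sum.cong) (auto simp: ftJ mult.assoc[symmetric] power_mult_distrib[symmetric])
  also have "\<dots> = 2 ^ ?m * ft P \<xi>" using I by (simp add: card_Pow)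
  finally have hi: "(G has_integral 2 ^ ?m * ft P \<xi>) UNIV" .
  have G0: "G x = 0" if x: "x \<notin> B" for x
  \<comment> \<open>If \<open>x\<close> lies in no translate, every term of \<open>G x\<close> is
    zero. Otherwise \<open>x\<close> is within distance 1 of \<open>P\<close>, hence in the ball
    that occurs in \<open>B\<close>.\<close>
  proof (cases "\<exists>J\<subseteq>I. x \<in> PJ J")
    case False
    then show ?thesis unfolding G_def by (intro sum.neutral) auto
  next
    case True
    then obtain J where "J \<subseteq> I" "x + w J \<in> P" by (auto simp: mem)
    then have "norm (x + w J) \<le> R" "norm (w J) \<le> 1" using P(2) wR by auto
    then have "x \<in> cball 0 (R + 1)" using norm_triangle_ineq4[of "x + w J" "w J"] by simp
    with x have "\<not> (i \<noteq> k \<and> \<bar>a i \<bullet> x - b i\<bar> \<le> \<delta> \<and> \<bar>a k \<bullet> x - b k\<bar> \<le> \<delta>)" if "i \<in> I" "k \<in> I" for i k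
      using that B(1) by blast
    \<comment> \<open>Outside \<open>B\<close> at most one constraint is nearly tight;
      \<open>i\<close> is that one, or arbitrary if there is none.\<close>
    then obtain i where i: "i \<in> I" "\<And>k. k \<in> I \<Longrightarrow> k \<noteq> i \<Longrightarrow> \<bar>a k \<bullet> x - b k\<bar> > \<delta>"
      using I(2) by (metis not_le ex_in_conv)
    show ?thesis unfolding G_def
    proof (rule sum_Pow_alternating_eq_0[OF I(1) i(1)])
      fix J assume J: "J \<subseteq> I - {i}"
      then have wi: "w (insert i J) = v i + w J"
        unfolding w_def using I(1) by (subst sum.insert) (auto dest: finite_subset)
      \<comment> \<open>Constraint \<open>i\<close> does not notice a translation by
        \<open>v i\<close>. Every other constraint holds or fails at \<open>x\<close> by a margin
        above \<open>\<delta>\<close>, which translations changing it by at most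
        \<open>\<delta>\<close> cannot reverse.\<close>
      have "a k \<bullet> (x + w (insert i J)) \<le> b k \<longleftrightarrow> a k \<bullet> (x + w J) \<le> b k" if "k \<in> I" for k
      proof (cases "k = i")
        case True
        then show ?thesis using av[OF i(1)] by (simp add: wi inner_add_right)
      next
        case False
        then have "\<bar>a k \<bullet> x - b k\<bar> > \<delta>" "\<bar>a k \<bullet> w (insert i J)\<bar> \<le> \<delta>" "\<bar>a k \<bullet> w J\<bar> \<le> \<delta>"
          using i that J small[of k "insert i J"] small[of k J] by auto
        then show ?thesis by (auto simp: inner_add_right abs_if split: if_splits)
      qed
      then have "x \<in> PJ (insert i J) \<longleftrightarrow> x \<in> PJ J" unfolding mem P(1) by auto
      then show "(if x \<in> PJ (insert i J) then ?e x else 0) = (if x \<in> PJ J then ?e x else 0)" by simp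
    qed
  qed
  \<comment> \<open>The bound is the same factor by which the integral of \<open>G\<close>
    multiplies the transform, so it cancels in the final estimate.\<close>
  have "norm (G x) \<le> 2 ^ ?m" for x
  proof -
    have "norm (G x) \<le> (\<Sum>J\<in>Pow I. 1)"
      unfolding G_def by (intro sum_norm_le) (auto simp: norm_mult norm_power)
    then show ?thesis using I by (simp add: card_Pow)
  qed
  moreover have "(\<lambda>x. if x \<in> B then G x else 0) = G" using G0 by auto
  then have "(G has_integral 2 ^ ?m * ft P \<xi>) B"
    using hi has_integral_restrict_UNIV[of B G] by simp
  ultimately have "norm (2 ^ ?m * ft P \<xi>) \<le> integral B (\<lambda>x. 2 ^ ?m)"
    using integral_norm_bound_integral[of G B "\<lambda>x. 2 ^ ?m"] integrable_on_const[OF B(2)]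
    by (metis has_integral_integrable_integral)
  also have "\<dots> = 2 ^ ?m * measure lebesgue B"
    using integral_mult_right[of B "2 ^ ?m" "\<lambda>_. 1::real"] lmeasure_integral[OF B(2)] by simp
  finally show ?thesis by (simp add: norm_mult norm_power)
qed

text \<open>Rescaled to be antiperiodic for the character, the vectors \<open>v i\<close> have
  length of order \<open>1 / \<bar>\<xi> $ j\<bar>\<close>, since the other coordinates of
  \<open>\<xi>\<close> stay bounded. Then \<open>norm_ft_halfspaces_le\<close> applies with
  \<open>\<delta>\<close> of this order, and a bound quadratic in \<open>\<delta>\<close> beats the
  factor \<open>\<bar>\<xi> $ j\<bar>\<close>.\<close>

lemma ft_halfspaces_decay:
  fixes a v :: "'i \<Rightarrow> real^'d"
  assumes P: "P = {x. \<forall>i\<in>I. a i \<bullet> x \<le> b i}" "bounded P" and I: "finite I" "I \<noteq> {}"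
    and a: "\<And>i. i \<in> I \<Longrightarrow> a i \<noteq> 0"
    and ne: "\<And>i k c. i \<in> I \<Longrightarrow> k \<in> I \<Longrightarrow> i \<noteq> k \<Longrightarrow> \<not> (a k = c *\<^sub>R a i \<and> b k = c * b i)"
    and v: "\<And>i. i \<in> I \<Longrightarrow> a i \<bullet> v i = 0 \<and> v i $ j = 1"
    and "0 < \<epsilon>"
  obtains T where "\<And>\<xi>. T \<le> \<bar>\<xi> $ j\<bar> \<Longrightarrow> (\<And>k. k \<noteq> j \<Longrightarrow> \<bar>\<xi> $ k\<bar> \<le> M) \<Longrightarrow> \<bar>\<xi> $ j\<bar> * norm (ft P \<xi>) \<le> \<epsilon>"
proof -
  obtain R where R: "P \<subseteq> cball 0 R" using P(2) by (auto simp: bounded_iff subset_iff)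
  define B where "B \<delta> = {x \<in> cball 0 (R + 1). \<exists>i\<in>I. \<exists>k\<in>I. i \<noteq> k \<and> \<bar>a i \<bullet> x - b i\<bar> \<le> \<delta> \<and> \<bar>a k \<bullet> x - b k\<bar> \<le> \<delta>}" for \<delta>
  obtain C D where CD: "0 < D" "0 \<le> C"
    "\<And>\<delta>. 0 < \<delta> \<Longrightarrow> \<delta> \<le> D \<Longrightarrow> measure lebesgue (B \<delta>) \<le> C * \<delta>\<^sup>2" "\<And>\<delta>. B \<delta> \<in> lmeasurable"
    unfolding B_def by (rule measure_two_slabs_Union[OF I(1) a ne, where R="R+1"]) blast+
  define V where "V = (\<Sum>i\<in>I. norm (v i))"
  define A where "A = 1 + (\<Sum>i\<in>I. norm (a i))"
  define L where "L = (\<Sum>i\<in>I. \<Sum>k\<in>UNIV. \<bar>v i $ k\<bar>)"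
  define E where "E = A * (V + 1)"
  have V: "0 \<le> V" and A: "0 < A" and L: "0 \<le> L"
    unfolding V_def A_def L_def by (auto intro!: sum_nonneg add_pos_nonneg)
  have E: "0 < E" unfolding E_def using V A by (intro mult_pos_pos) auto
  show ?thesis
  \<comment> \<open>In order, the summands ensure \<open>1 \<le> X\<close>, translations of length
    at most 1, \<open>X / 2 \<le> \<bar>\<xi> \<bullet> v i\<bar>\<close>,
    \<open>\<delta> \<le> D\<close>, and \<open>C * E\<^sup>2 / X \<le> \<epsilon>\<close> at the
    end.\<close>
  proof (rule that[of "1 + V + 2 * \<bar>M\<bar> * L + E / D + C * E\<^sup>2 / \<epsilon>"])
    fix \<xi> :: "real^'d"
    assume T: "1 + V + 2 * \<bar>M\<bar> * L + E / D + C * E\<^sup>2 / \<epsilon> \<le> \<bar>\<xi> $ j\<bar>" and M: "\<And>k. k \<noteq> j \<Longrightarrow> \<bar>\<xi> $ k\<bar> \<le> M"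
    define X where "X = \<bar>\<xi> $ j\<bar>"
    have nn: "0 \<le> 2 * \<bar>M\<bar> * L" "0 \<le> E / D" "0 \<le> C * E\<^sup>2 / \<epsilon>"
      using L E CD \<open>0 < \<epsilon>\<close> by auto
    then have X: "1 \<le> X" "V \<le> X" "2 * \<bar>M\<bar> * L \<le> X" "E / D \<le> X" "C * E\<^sup>2 / \<epsilon> \<le> X"
      using T V unfolding X_def by linarith+
    have half: "X / 2 \<le> \<bar>\<xi> \<bullet> v i\<bar>" if "i \<in> I" for i
    proof -
      have "\<xi> \<bullet> v i = \<xi> $ j + (\<Sum>k\<in>UNIV - {j}. \<xi> $ k * v i $ k)"
        using v[OF that] by (simp add: inner_vec_def sum.remove[of UNIV j])
      moreover have "\<bar>\<Sum>k\<in>UNIV - {j}. \<xi> $ k * v i $ k\<bar> \<le> (\<Sum>k\<in>UNIV - {j}. \<bar>M\<bar> * \<bar>v i $ k\<bar>)"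
        using M by (intro order.trans[OF sum_abs] sum_mono)
          (auto simp: abs_mult intro!: mult_right_mono order.trans[OF M])
      moreover have "(\<Sum>k\<in>UNIV - {j}. \<bar>M\<bar> * \<bar>v i $ k\<bar>) \<le> \<bar>M\<bar> * L"
      proof -
        have "(\<Sum>k\<in>UNIV - {j}. \<bar>v i $ k\<bar>) \<le> (\<Sum>k\<in>UNIV. \<bar>v i $ k\<bar>)" by (intro sum_mono2) auto
        also have "\<dots> \<le> L" unfolding L_def using that I(1)
          by (intro member_le_sum[of i I "\<lambda>i. \<Sum>k\<in>UNIV. \<bar>v i $ k\<bar>"]) (auto intro: sum_nonneg)
        finally show ?thesis by (simp flip: sum_distrib_left add: mult_left_mono)
      qed
      ultimately show ?thesis using X(3) unfolding X_def by linarith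
    qed
    \<comment> \<open>The scaling makes \<open>\<xi> \<bullet> u i = 1 / 2\<close>; by
      \<open>half\<close> it shrinks the vector by a factor of at most \<open>1 / X\<close>.\<close>
    define u where "u i = (1 / (2 * (\<xi> \<bullet> v i))) *\<^sub>R v i" for i
    have nu: "norm (u i) \<le> norm (v i) / X" if "i \<in> I" for i
    proof -
      have "norm (u i) = norm (v i) / (2 * \<bar>\<xi> \<bullet> v i\<bar>)" by (simp add: u_def abs_mult divide_simps)
      also have "\<dots> \<le> norm (v i) / X" using half[OF that] X(1) by (intro divide_left_mono) auto
      finally show ?thesis .
    qed
    have nw: "norm (\<Sum>i\<in>J. u i) \<le> V / X" if "J \<subseteq> I" for J
    proof -
      have "norm (\<Sum>i\<in>J. u i) \<le> (\<Sum>i\<in>J. norm (v i) / X)"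
        using that nu by (intro sum_norm_le) auto
      also have "\<dots> \<le> (\<Sum>i\<in>I. norm (v i) / X)" using that I(1) X(1) by (intro sum_mono2) auto
      also have "\<dots> = V / X" by (simp add: V_def sum_divide_distrib)
      finally show ?thesis .
    qed
    define \<delta> where "\<delta> = E / X"
    have \<delta>: "0 < \<delta>" "\<delta> \<le> D" using E X(1,4) CD(1) by (auto simp: \<delta>_def field_simps)
    have "norm (ft P \<xi>) \<le> measure lebesgue (B \<delta>)"
    proof (rule norm_ft_halfspaces_le[OF P(1) R I, where v=u and \<delta>=\<delta>])
      fix i assume i: "i \<in> I"
      show "a i \<bullet> u i = 0" using v[OF i] by (simp add: u_def)
      have "\<xi> \<bullet> v i \<noteq> 0" using half[OF i] X(1) by auto
      then show "\<xi> \<bullet> u i = 1 / 2" by (simp add: u_def)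
      fix J assume J: "J \<subseteq> I"
      have "\<bar>a i \<bullet> (\<Sum>i\<in>J. u i)\<bar> \<le> norm (a i) * norm (\<Sum>i\<in>J. u i)" by (rule Cauchy_Schwarz_ineq2)
      also have "\<dots> \<le> A * ((V + 1) / X)"
      proof (intro mult_mono)
        show "norm (a i) \<le> A" unfolding A_def
          using i I(1) member_le_sum[of i I "\<lambda>i. norm (a i)"] by auto
        show "norm (\<Sum>i\<in>J. u i) \<le> (V + 1) / X" using nw[OF J] X(1) by (auto simp: add_divide_distrib intro: add_increasing2)
      qed (use A in auto)
      finally show "\<bar>a i \<bullet> (\<Sum>i\<in>J. u i)\<bar> \<le> \<delta>" by (simp add: \<delta>_def E_def)
    next
      fix J assume "J \<subseteq> I"
      from nw[OF this] X V show "norm (\<Sum>i\<in>J. u i) \<le> 1" by (auto elim!: order_trans simp: divide_le_eq)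
    qed (use CD(4) in \<open>auto simp: B_def\<close>)
    also have "\<dots> \<le> C * \<delta>\<^sup>2" using CD(3) \<delta> by blast
    finally have "X * norm (ft P \<xi>) \<le> X * (C * \<delta>\<^sup>2)" using X(1) by (intro mult_left_mono) auto
    also have "\<dots> = C * E\<^sup>2 / X" using X(1) by (simp add: \<delta>_def power2_eq_square)
    also have "\<dots> \<le> \<epsilon>" using X(1,5) \<open>0 < \<epsilon>\<close> by (simp add: field_simps)
    finally show "\<bar>\<xi> $ j\<bar> * norm (ft P \<xi>) \<le> \<epsilon>" unfolding X_def .
  qed
qed

text \<open>In an irredundant description by half-spaces every constraint defines a facet. As
  \<open>axis j 1\<close> is not normal to it, each facet is parallel to a vector with
  \<open>j\<close>-th coordinate 1, as \<open>ft_halfspaces_decay\<close> requires.\<close>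

lemma ft_polytope_decay:
  fixes P :: "(real^'d) set"
  assumes P: "polytope P" "0 < measure lebesgue P"
    and facets: "\<And>F u. F facet_of P \<Longrightarrow> unit_outward_normal P F u \<Longrightarrow> u \<noteq> axis j 1 \<and> u \<noteq> - axis j 1"
    and \<epsilon>: "0 < \<epsilon>"
  obtains T where "\<And>\<xi>. T \<le> \<bar>\<xi> $ j\<bar> \<Longrightarrow> (\<And>k. k \<noteq> j \<Longrightarrow> \<bar>\<xi> $ k\<bar> \<le> M) \<Longrightarrow> \<bar>\<xi> $ j\<bar> * norm (ft P \<xi>) \<le> \<epsilon>"
proof -
  have nonneg: "\<not> negligible P" using P(2) by (auto simp: negligible_imp_measure0)
  then have "interior P \<noteq> {}"
    using negligible_convex_interior[of P] P(1) polytope_imp_convex by blast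
  then have hull: "affine hull P = UNIV" by (rule affine_hull_nonempty_interior)
  have "polyhedron P" using P(1) by (rule polytope_imp_polyhedron)
  then have "\<exists>I. finite I \<and> P = affine hull P \<inter> \<Inter>I \<and> (\<forall>h\<in>I. \<exists>a b. a \<noteq> 0 \<and> h = {x. a \<bullet> x \<le> b}) \<and>
      (\<forall>I'. I' \<subset> I \<longrightarrow> P \<subset> affine hull P \<inter> \<Inter>I')"
    by (rule polyhedron_Int_affine_minimal[THEN iffD1])
  then obtain I where *: "finite I \<and> P = affine hull P \<inter> \<Inter>I \<and> (\<forall>h\<in>I. \<exists>a b. a \<noteq> 0 \<and> h = {x. a \<bullet> x \<le> b}) \<and>
      (\<forall>I'. I' \<subset> I \<longrightarrow> P \<subset> affine hull P \<inter> \<Inter>I')" ..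
  note I = *[THEN conjunct1] *[THEN conjunct2, THEN conjunct1]
  note Iab = *[THEN conjunct2, THEN conjunct2, THEN conjunct1]
  note min' = *[THEN conjunct2, THEN conjunct2, THEN conjunct2]
  note min = min'[rule_format]
  from bchoice[OF Iab] obtain a where a: "\<forall>h\<in>I. \<exists>b. a h \<noteq> 0 \<and> h = {x. a h \<bullet> x \<le> b}" ..
  from bchoice[OF a] obtain b where b: "\<forall>h\<in>I. a h \<noteq> 0 \<and> h = {x. a h \<bullet> x \<le> b h}" ..
  note a0 = bspec[OF b, THEN conjunct1]
  from bspec[OF b] have ab: "\<And>h. h \<in> I \<Longrightarrow> a h \<noteq> 0 \<and> h = {x. a h \<bullet> x \<le> b h}" .
  have "x \<in> h \<longleftrightarrow> a h \<bullet> x \<le> b h" if "h \<in> I" for x h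
  proof -
    have "x \<in> A \<longleftrightarrow> Q x" if "A = Collect Q" for A Q using that by simp
    from this[OF ab[OF that, THEN conjunct2]] show ?thesis .
  qed
  then have "\<Inter>I = {x. \<forall>h\<in>I. a h \<bullet> x \<le> b h}" by auto
  then have PI: "P = {x. \<forall>h\<in>I. a h \<bullet> x \<le> b h}" using I(2) unfolding hull by simp
  have bdd: "bounded P" using P(1) by (rule polytope_imp_bounded)
  then have "I \<noteq> {}" using I(2) hull not_bounded_UNIV by fastforce
  \<comment> \<open>For positive \<open>c\<close> the two half-spaces coincide; for negative
    \<open>c\<close> they are opposite and squeeze \<open>P\<close> into a hyperplane, which is
    negligible.\<close>
  have ne: "\<not> (a k = c *\<^sub>R a h \<and> b k = c * b h)" if hk: "h \<in> I" "k \<in> I" "h \<noteq> k" for h k c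
  proof
    assume c: "a k = c *\<^sub>R a h \<and> b k = c * b h"
    show False
    proof (cases "c > 0")
      case True
      then have eq: "{x. a k \<bullet> x \<le> b k} = {x. a h \<bullet> x \<le> b h}" using c by auto
      have "h = k"
        by (rule trans[OF ab[OF hk(1), THEN conjunct2] trans[OF eq[symmetric] ab[OF hk(2), THEN conjunct2, symmetric]]])
      then show False using hk(3) by simp
    next
      case False
      then have "c < 0" using c a0[OF hk(2)] by (cases "c = 0") auto
      have "P \<subseteq> {x. a h \<bullet> x = b h}"
      proof
        fix x assume "x \<in> P"
        then have "a h \<bullet> x \<le> b h" "a k \<bullet> x \<le> b k" using hk unfolding PI by auto
        then show "x \<in> {x. a h \<bullet> x = b h}" using c \<open>c < 0\<close> by (auto simp: mult_le_cancel_left)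
      qed
      then show False using negligible_hyperplane[of "a h" "b h"] a0[OF hk(1)] negligible_subset nonneg by blast
    qed
  qed
  have "\<exists>v. a h \<bullet> v = 0 \<and> v $ j = 1" if h: "h \<in> I" for h
  proof -
    let ?a = "a h" and ?e = "axis j 1 :: real^'d"
    \<comment> \<open>The projection of \<open>?e\<close> onto the directions of the facet. Its
      \<open>j\<close>-th coordinate is \<open>w \<bullet> w\<close>, which vanishes only if
      \<open>?e\<close> is a multiple of the normal.\<close>
    define w where "w = ?e - (?a $ j / (?a \<bullet> ?a)) *\<^sub>R ?a"
    have aw: "?a \<bullet> w = 0" using a0[OF h] by (simp add: w_def inner_diff_right inner_axis)
    have "w $ j \<noteq> 0"
    proof
      assume "w $ j = 0"
      then have "w \<bullet> w = 0"
        using aw by (subst (1) w_def) (simp add: inner_diff_left inner_axis')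
      then have "?e = (?a $ j / (?a \<bullet> ?a)) *\<^sub>R ?a" by (simp add: w_def)
      moreover define c where "c = ?a $ j / (?a \<bullet> ?a)"
      ultimately have e: "?e = c *\<^sub>R ?a" by simp
      then have c1: "\<bar>c\<bar> * norm ?a = 1" by (metis norm_axis_1 norm_scaleR)
      define u where "u = (1 / norm ?a) *\<^sub>R ?a"
      have "P \<inter> {x. ?a \<bullet> x = b h} facet_of P"
        by (subst facet_of_polyhedron_explicit[OF I(1,2) ab min]) (use h in auto)
      moreover have "unit_outward_normal P (P \<inter> {x. ?a \<bullet> x = b h}) u"
        unfolding unit_outward_normal_def
        using a0[OF h] h by (auto simp: u_def PI divide_le_cancel intro!: exI[of _ "b h / norm ?a"])
      ultimately have "u \<noteq> ?e \<and> u \<noteq> - ?e" by (rule facets)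
      moreover have "1 / norm ?a = \<bar>c\<bar>" using c1 a0[OF h] by (simp add: field_simps)
      then have "u = ?e \<or> u = - ?e" unfolding u_def e by (auto simp: abs_if)
      ultimately show False by blast
    qed
    then show ?thesis using aw by (intro exI[of _ "(1 / w $ j) *\<^sub>R w"]) simp
  qed
  then obtain v where v: "\<And>h. h \<in> I \<Longrightarrow> a h \<bullet> v h = 0 \<and> v h $ j = 1" by metis
  show ?thesis
    by (rule ft_halfspaces_decay[OF PI bdd I(1) \<open>I \<noteq> {}\<close> a0 ne v \<epsilon>, where M=M]) (use that in blast)+
qed

subsection \<open>Bessel and Parseval\<close>

text \<open>All functions that occur are bounded, so that no integrability question arises.\<close>
definition bdd_meas :: "'a::euclidean_space set \<Rightarrow> ('a \<Rightarrow> complex) \<Rightarrow> bool" where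
  "bdd_meas \<Omega> f \<longleftrightarrow> f \<in> borel_measurable (lebesgue_on \<Omega>) \<and> (\<exists>B. \<forall>x. norm (f x) \<le> B)"

lemma bdd_measI: "f \<in> borel_measurable (lebesgue_on \<Omega>) \<Longrightarrow> (\<And>x. norm (f x) \<le> B) \<Longrightarrow> bdd_meas \<Omega> f"
  unfolding bdd_meas_def by blast

lemma bdd_meas_mult: 
  assumes "bdd_meas \<Omega> f" "bdd_meas \<Omega> g"
  shows "bdd_meas \<Omega> (\<lambda>x. f x * g x)"
proof -
  obtain B C where "\<And>x. norm (f x) \<le> B" "\<And>x. norm (g x) \<le> C" using assms unfolding bdd_meas_def by blast
  then have "norm (f x * g x) \<le> B * C" for x
    unfolding norm_mult by (meson mult_mono norm_ge_zero order_trans)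
  then show ?thesis using assms unfolding bdd_meas_def by (auto intro!: borel_measurable_times)
qed

lemma bdd_meas_add: 
  assumes "bdd_meas \<Omega> f" "bdd_meas \<Omega> g"
  shows "bdd_meas \<Omega> (\<lambda>x. f x + g x)"
proof -
  obtain B C where "\<And>x. norm (f x) \<le> B" "\<And>x. norm (g x) \<le> C" using assms unfolding bdd_meas_def by blast
  then have "norm (f x + g x) \<le> B + C" for x by (meson add_mono norm_triangle_le)
  then show ?thesis using assms unfolding bdd_meas_def by (auto intro!: borel_measurable_add)
qed

lemma bdd_meas_const: "bdd_meas \<Omega> (\<lambda>x. c)"
  by (rule bdd_measI[where B="norm c"]) auto

lemma bdd_meas_cnj: "bdd_meas \<Omega> f \<Longrightarrow> bdd_meas \<Omega> (\<lambda>x. cnj (f x))"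
  unfolding bdd_meas_def
  using measurable_compose[OF _ borel_measurable_continuous_onI[of cnj], of f] by (auto intro: continuous_intros)

lemma bdd_meas_diff: 
  assumes "bdd_meas \<Omega> f" "bdd_meas \<Omega> g"
  shows "bdd_meas \<Omega> (\<lambda>x. f x - g x)"
  using bdd_meas_add[OF assms(1) bdd_meas_mult[OF bdd_meas_const[of _ "-1"] assms(2)]] by simp

lemma bdd_meas_sum: 
  "(\<And>i. i \<in> S \<Longrightarrow> bdd_meas \<Omega> (f i)) \<Longrightarrow> bdd_meas \<Omega> (\<lambda>x. \<Sum>i\<in>S. f i x)"
  by (induction S rule: infinite_finite_induct) (auto intro: bdd_meas_add bdd_meas_const)

lemma finite_measure_lebesgue_on: "\<Omega> \<in> lmeasurable \<Longrightarrow> finite_measure (lebesgue_on \<Omega>)"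
  by (intro finite_measureI) (auto simp: emeasure_restrict_space fmeasurable_def)

lemma bdd_meas_integrable:
  assumes "\<Omega> \<in> lmeasurable" "bdd_meas \<Omega> f"
  shows "integrable (lebesgue_on \<Omega>) f"
proof -
  interpret finite_measure "lebesgue_on \<Omega>" using assms(1) by (rule finite_measure_lebesgue_on)
  from assms(2) show ?thesis unfolding bdd_meas_def by (auto intro: integrable_const_bound)
qed

context
  fixes \<Omega> :: "'a::euclidean_space set"
  assumes \<Omega>: "\<Omega> \<in> lmeasurable"
begin

lemmas bdd_meas_rules = bdd_meas_mult bdd_meas_add bdd_meas_diff bdd_meas_cnj bdd_meas_const bdd_meas_sum

lemma bdd_meas_L2: "bdd_meas \<Omega> f \<Longrightarrow> f \<in> L2_space \<Omega>"
proof -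
  assume f: "bdd_meas \<Omega> f"
  have "integrable (lebesgue_on \<Omega>) (\<lambda>x. f x * cnj (f x))"
    by (intro bdd_meas_integrable \<Omega> bdd_meas_rules f)
  then have "integrable (lebesgue_on \<Omega>) (\<lambda>x. (norm (f x))\<^sup>2)"
    unfolding complex_norm_square[symmetric] complex_of_real_integrable_eq .
  then show ?thesis using f unfolding L2_space_def bdd_meas_def by auto
qed

lemma L2_inner_diff_left:
  assumes "bdd_meas \<Omega> f" "bdd_meas \<Omega> g" "bdd_meas \<Omega> h"
  shows "L2_inner \<Omega> (\<lambda>x. f x - g x) h = L2_inner \<Omega> f h - L2_inner \<Omega> g h"
  unfolding L2_inner_def left_diff_distrib
  by (intro Bochner_Integration.integral_diff bdd_meas_integrable \<Omega> bdd_meas_rules assms)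

lemma L2_inner_sum_left:
  assumes "\<And>i. i \<in> S \<Longrightarrow> bdd_meas \<Omega> (e i)" "bdd_meas \<Omega> h"
  shows "L2_inner \<Omega> (\<lambda>x. \<Sum>i\<in>S. c i * e i x) h = (\<Sum>i\<in>S. c i * L2_inner \<Omega> (e i) h)"
proof -
  have "L2_inner \<Omega> (\<lambda>x. \<Sum>i\<in>S. c i * e i x) h = (LINT x|lebesgue_on \<Omega>. (\<Sum>i\<in>S. c i * (e i x * cnj (h x))))"
    unfolding L2_inner_def sum_distrib_right mult.assoc ..
  also have "\<dots> = (\<Sum>i\<in>S. (LINT x|lebesgue_on \<Omega>. c i * (e i x * cnj (h x))))"
    by (intro Bochner_Integration.integral_sum bdd_meas_integrable \<Omega> bdd_meas_rules assms) auto
  finally show ?thesis unfolding L2_inner_def by simp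
qed

lemma L2_inner_commute: "L2_inner \<Omega> g f = cnj (L2_inner \<Omega> f g)"
  unfolding L2_inner_def Bochner_Integration.integral_cnj[symmetric] by (simp add: mult.commute)

lemma L2_inner_diff_right:
  assumes "bdd_meas \<Omega> f" "bdd_meas \<Omega> g" "bdd_meas \<Omega> h"
  shows "L2_inner \<Omega> h (\<lambda>x. f x - g x) = L2_inner \<Omega> h f - L2_inner \<Omega> h g"
  using L2_inner_diff_left[OF assms] by (metis L2_inner_commute complex_cnj_diff)

lemma L2_inner_sum_right:
  assumes "\<And>i. i \<in> S \<Longrightarrow> bdd_meas \<Omega> (e i)" "bdd_meas \<Omega> h"
  shows "L2_inner \<Omega> h (\<lambda>x. \<Sum>i\<in>S. c i * e i x) = (\<Sum>i\<in>S. cnj (c i) * L2_inner \<Omega> h (e i))"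
  using arg_cong[OF L2_inner_sum_left[where e=e and S=S and c=c, OF assms], where f=cnj]
  by (simp add: L2_inner_commute[symmetric] cnj_sum)

lemma L2_norm_eq: "(L2_norm \<Omega> f)\<^sup>2 = Re (L2_inner \<Omega> f f)" "L2_inner \<Omega> f f = (L2_norm \<Omega> f)\<^sup>2"
proof -
  have "L2_inner \<Omega> f f = complex_of_real (LINT x|lebesgue_on \<Omega>. (norm (f x))\<^sup>2)"
    unfolding L2_inner_def complex_norm_square[symmetric] by (rule integral_complex_of_real)
  moreover have "(LINT x|lebesgue_on \<Omega>. (norm (f x))\<^sup>2) = (L2_norm \<Omega> f)\<^sup>2"
    unfolding L2_norm_def by (subst real_sqrt_pow2) (auto intro: Bochner_Integration.integral_nonneg)
  ultimately show "L2_inner \<Omega> f f = (L2_norm \<Omega> f)\<^sup>2" by simp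
  then show "(L2_norm \<Omega> f)\<^sup>2 = Re (L2_inner \<Omega> f f)" by simp
qed

text \<open>The pointwise bound \<open>norm (f x) \<le> (norm (f x))\<^sup>2 / \<epsilon> +
  \<epsilon>\<close> is integrated. With \<open>\<epsilon>\<close> of the size of the norm of
  \<open>f\<close>, it serves in place of the Cauchy-Schwarz inequality.\<close>

lemma L2_inner_le:
  assumes f: "bdd_meas \<Omega> f" and g: "bdd_meas \<Omega> g" "\<And>x. norm (g x) \<le> 1" and "0 < \<epsilon>"
  shows "norm (L2_inner \<Omega> f g) \<le> (L2_norm \<Omega> f)\<^sup>2 / \<epsilon> + \<epsilon> * measure lebesgue \<Omega>"
proof -
  have sq: "integrable (lebesgue_on \<Omega>) (\<lambda>x. (norm (f x))\<^sup>2)"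
    using bdd_meas_L2[OF f] by (simp add: L2_space_def)
  interpret finite_measure "lebesgue_on \<Omega>" using \<Omega> by (rule finite_measure_lebesgue_on)
  have "norm (L2_inner \<Omega> f g) \<le> (LINT x|lebesgue_on \<Omega>. norm (f x * cnj (g x)))"
    unfolding L2_inner_def by (rule integral_norm_bound)
  also have "\<dots> \<le> (LINT x|lebesgue_on \<Omega>. (norm (f x))\<^sup>2 / \<epsilon> + \<epsilon>)"
  proof (rule Bochner_Integration.integral_mono)
    show "integrable (lebesgue_on \<Omega>) (\<lambda>x. norm (f x * cnj (g x)))"
      by (intro integrable_norm bdd_meas_integrable \<Omega> bdd_meas_rules f g)
    show "integrable (lebesgue_on \<Omega>) (\<lambda>x. (norm (f x))\<^sup>2 / \<epsilon> + \<epsilon>)" using sq by auto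
    fix x
    have "norm (f x * cnj (g x)) \<le> norm (f x)"
      using g(2)[of x] by (simp add: norm_mult mult_left_le)
    also have "0 \<le> (norm (f x) - \<epsilon>)\<^sup>2 + norm (f x) * \<epsilon>" using \<open>0 < \<epsilon>\<close> by auto
    then have "norm (f x) \<le> (norm (f x))\<^sup>2 / \<epsilon> + \<epsilon>"
      using \<open>0 < \<epsilon>\<close> by (simp add: field_simps power2_eq_square)
    finally show "norm (f x * cnj (g x)) \<le> (norm (f x))\<^sup>2 / \<epsilon> + \<epsilon>" .
  qed
  also have "\<dots> = (L2_norm \<Omega> f)\<^sup>2 / \<epsilon> + \<epsilon> * measure lebesgue \<Omega>"
    using sq \<Omega> by (simp add: L2_norm_def measure_restrict_space fmeasurableD)
  finally show ?thesis .
qed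

text \<open>Completing the square in the coefficients. The last sum vanishes exactly for the Fourier
  coefficients, which yields Bessel's inequality and shows that they are the best choice.\<close>

lemma L2_norm_diff_combination:
  assumes e: "\<And>i. i \<in> S \<Longrightarrow> bdd_meas \<Omega> (e i)" and f: "bdd_meas \<Omega> f" and S: "finite S"
    and orth: "\<And>i k. i \<in> S \<Longrightarrow> k \<in> S \<Longrightarrow> L2_inner \<Omega> (e i) (e k) = (if i = k then complex_of_real A else 0)"
    and A: "A > 0"
  shows "(L2_norm \<Omega> (\<lambda>x. f x - (\<Sum>i\<in>S. c i * e i x)))\<^sup>2 =
    (L2_norm \<Omega> f)\<^sup>2 - (\<Sum>i\<in>S. (norm (L2_inner \<Omega> f (e i)))\<^sup>2) / A
      + A * (\<Sum>i\<in>S. (norm (c i - L2_inner \<Omega> f (e i) / A))\<^sup>2)"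
proof -
  let ?p = "\<lambda>x. \<Sum>i\<in>S. c i * e i x" and ?d = "\<lambda>i. L2_inner \<Omega> f (e i)"
  have p: "bdd_meas \<Omega> ?p" by (intro bdd_meas_rules e)
  have pe: "L2_inner \<Omega> ?p (e k) = c k * A" if "k \<in> S" for k
  proof -
    have "L2_inner \<Omega> ?p (e k) = (\<Sum>i\<in>S. c i * L2_inner \<Omega> (e i) (e k))"
      using that by (intro L2_inner_sum_left e)
    also have "\<dots> = (\<Sum>i\<in>S. if i = k then c k * A else 0)"
      using that orth by (intro sum.cong) auto
    finally show ?thesis using that S by simp
  qed
  have "L2_inner \<Omega> (\<lambda>x. f x - ?p x) (\<lambda>x. f x - ?p x)
      = L2_inner \<Omega> f f - L2_inner \<Omega> f ?p - (L2_inner \<Omega> ?p f - L2_inner \<Omega> ?p ?p)"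
    by (simp add: L2_inner_diff_left L2_inner_diff_right f p bdd_meas_diff)
  also have "L2_inner \<Omega> f ?p = (\<Sum>i\<in>S. cnj (c i) * ?d i)" by (intro L2_inner_sum_right e f)
  also have "L2_inner \<Omega> ?p f = (\<Sum>i\<in>S. c i * cnj (?d i))"
    by (subst L2_inner_sum_left) (auto intro: e f simp: L2_inner_commute[of f])
  also have "L2_inner \<Omega> ?p ?p = (\<Sum>i\<in>S. cnj (c i) * (c i * A))"
    by (subst L2_inner_sum_right[OF _ p]) (auto intro: e p simp: pe cong: sum.cong)
  also have "L2_inner \<Omega> f f - (\<Sum>i\<in>S. cnj (c i) * ?d i) - ((\<Sum>i\<in>S. c i * cnj (?d i)) - (\<Sum>i\<in>S. cnj (c i) * (c i * A)))
     = L2_inner \<Omega> f f - (\<Sum>i\<in>S. ?d i * cnj (?d i)) / A + A * (\<Sum>i\<in>S. (c i - ?d i / A) * cnj (c i - ?d i / A))"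
    using A by (simp add: sum_distrib_left sum_divide_distrib algebra_simps flip: sum.distrib sum_subtractf)
  finally have "complex_of_real ((L2_norm \<Omega> (\<lambda>x. f x - ?p x))\<^sup>2) = complex_of_real ((L2_norm \<Omega> f)\<^sup>2 - (\<Sum>i\<in>S. (norm (?d i))\<^sup>2) / A
      + A * (\<Sum>i\<in>S. (norm (c i - ?d i / A))\<^sup>2))"
    unfolding L2_norm_eq(2) complex_norm_square[symmetric] by simp
  then show ?thesis unfolding of_real_eq_iff .
qed

lemma bessel:
  assumes e: "\<And>i. i \<in> S \<Longrightarrow> bdd_meas \<Omega> (e i)" and f: "bdd_meas \<Omega> f" and S: "finite S"
    and orth: "\<And>i k. i \<in> S \<Longrightarrow> k \<in> S \<Longrightarrow> L2_inner \<Omega> (e i) (e k) = (if i = k then complex_of_real A else 0)"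
    and A: "A > 0"
  shows "(\<Sum>i\<in>S. (norm (L2_inner \<Omega> f (e i)))\<^sup>2) \<le> A * (L2_norm \<Omega> f)\<^sup>2"
proof -
  let ?c = "\<lambda>i. L2_inner \<Omega> f (e i) / A"
  have "0 \<le> (L2_norm \<Omega> (\<lambda>x. f x - (\<Sum>i\<in>S. ?c i * e i x)))\<^sup>2" by simp
  also have "\<dots> = (L2_norm \<Omega> f)\<^sup>2 - (\<Sum>i\<in>S. (norm (L2_inner \<Omega> f (e i)))\<^sup>2) / A"
    by (subst L2_norm_diff_combination[OF e f S orth A]) auto
  finally show ?thesis using A by (simp add: field_simps)
qed

text \<open>Parseval's identity up to an error, with a finite sum. Density supplies a finite
  combination close to \<open>f\<close>; on the same index set the Fourier coefficients do at least
  as well, and the small remainder is paired with \<open>g\<close>.\<close>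

lemma parseval_approx:
  assumes basis: "orthogonal_basis_L2 \<Omega> I e" and e: "\<And>i. i \<in> I \<Longrightarrow> bdd_meas \<Omega> (e i)"
    and eA: "\<And>i. i \<in> I \<Longrightarrow> L2_inner \<Omega> (e i) (e i) = complex_of_real A" and A: "A > 0"
    and f: "bdd_meas \<Omega> f" and g: "bdd_meas \<Omega> g" "\<And>x. norm (g x) \<le> 1" and "0 < \<epsilon>"
  obtains S where "finite S" "S \<subseteq> I"
    "norm (A * L2_inner \<Omega> f g - (\<Sum>i\<in>S. L2_inner \<Omega> f (e i) * L2_inner \<Omega> (e i) g)) \<le> \<epsilon>"
proof -
  have orth: "L2_inner \<Omega> (e i) (e k) = (if i = k then complex_of_real A else 0)" if "i \<in> I" "k \<in> I" for i k
    using basis eA that unfolding orthogonal_basis_L2_def by auto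
  define m where "m = measure lebesgue \<Omega>"
  have m: "m \<ge> 0" by (simp add: m_def)
  \<comment> \<open>Chosen so that the resulting error \<open>\<eta> * (A * (1 + m))\<close> equals
    \<open>\<epsilon>\<close>.\<close>
  define \<eta> where "\<eta> = \<epsilon> / (A * (1 + m))"
  have \<eta>: "\<eta> > 0" using A m \<open>0 < \<epsilon>\<close> by (auto simp: \<eta>_def intro!: divide_pos_pos mult_pos_pos add_pos_nonneg)
  have "\<exists>S c. finite S \<and> S \<subseteq> I \<and> L2_norm \<Omega> (\<lambda>x. f x - (\<Sum>i\<in>S. c i * e i x)) < \<eta>"
    using basis bdd_meas_L2[OF f] \<eta> unfolding orthogonal_basis_L2_def by blast
  then obtain S c where S: "finite S" "S \<subseteq> I" and c: "L2_norm \<Omega> (\<lambda>x. f x - (\<Sum>i\<in>S. c i * e i x)) < \<eta>" by blast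
  have e': "\<And>i. i \<in> S \<Longrightarrow> bdd_meas \<Omega> (e i)" using e S by blast
  have orth': "\<And>i k. i \<in> S \<Longrightarrow> k \<in> S \<Longrightarrow> L2_inner \<Omega> (e i) (e k) = (if i = k then complex_of_real A else 0)"
    using orth S by blast
  let ?d = "\<lambda>i. L2_inner \<Omega> f (e i) / A"
  let ?r = "\<lambda>x. f x - (\<Sum>i\<in>S. ?d i * e i x)"
  have "(L2_norm \<Omega> ?r)\<^sup>2 \<le> (L2_norm \<Omega> (\<lambda>x. f x - (\<Sum>i\<in>S. c i * e i x)))\<^sup>2"
    using A by (simp only: L2_norm_diff_combination[OF e' f S(1) orth' A]) (simp add: sum_nonneg)
  also have "\<dots> \<le> \<eta>\<^sup>2" using c by (intro power_mono) (auto simp: L2_norm_def Bochner_Integration.integral_nonneg)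
  finally have r: "(L2_norm \<Omega> ?r)\<^sup>2 \<le> \<eta>\<^sup>2" .
  have "L2_inner \<Omega> ?r g = L2_inner \<Omega> f g - L2_inner \<Omega> (\<lambda>x. \<Sum>i\<in>S. ?d i * e i x) g"
    by (intro L2_inner_diff_left bdd_meas_rules f g e')
  also have "L2_inner \<Omega> (\<lambda>x. \<Sum>i\<in>S. ?d i * e i x) g = (\<Sum>i\<in>S. ?d i * L2_inner \<Omega> (e i) g)"
    by (intro L2_inner_sum_left e' g)
  finally have "A * L2_inner \<Omega> f g - (\<Sum>i\<in>S. L2_inner \<Omega> f (e i) * L2_inner \<Omega> (e i) g) = A * L2_inner \<Omega> ?r g"
    using A by (simp add: right_diff_distrib sum_distrib_left)
  then have "norm (A * L2_inner \<Omega> f g - (\<Sum>i\<in>S. L2_inner \<Omega> f (e i) * L2_inner \<Omega> (e i) g)) = A * norm (L2_inner \<Omega> ?r g)"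
    using A by (simp add: norm_mult)
  also have "\<dots> \<le> A * ((L2_norm \<Omega> ?r)\<^sup>2 / \<eta> + \<eta> * m)"
    unfolding m_def using A e' by (intro mult_left_mono L2_inner_le bdd_meas_rules f g \<eta>) auto
  also have "\<dots> \<le> A * (\<eta>\<^sup>2 / \<eta> + \<eta> * m)"
    using A r \<eta> by (intro mult_left_mono add_right_mono divide_right_mono) auto
  also have "\<dots> = \<eta> * (A * (1 + m))" using \<eta> by (simp add: power2_eq_square algebra_simps)
  also have "\<dots> = \<epsilon>" using A m unfolding \<eta>_def by auto
  finally show ?thesis using that S by blast
qed

end

section \<open>Characters and spectra\<close>

abbreviation character :: "'a::euclidean_space \<Rightarrow> 'a \<Rightarrow> complex" where
  "character l \<equiv> \<lambda>x. cis (2 * pi * (l \<bullet> x))"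

text \<open>Extension by zero makes a character on \<open>X \<subseteq> \<Omega>\<close> a vector of
  \<open>L2_space \<Omega>\<close> whose inner products with characters are values of
  \<open>ft X\<close>.\<close>

definition character_on :: "'a::euclidean_space set \<Rightarrow> 'a \<Rightarrow> 'a \<Rightarrow> complex" where
  "character_on X l x = (if x \<in> X then character l x else 0)"

lemma bdd_meas_character: "bdd_meas \<Omega> (character l)"
  by (rule bdd_measI[where B=1]) (auto intro: cis_inner_measurable_lebesgue_on)

lemma norm_character_on_le: "norm (character_on X l x) \<le> 1"
  by (simp add: character_on_def)

lemma bdd_meas_character_on:
  assumes "\<Omega> \<in> lmeasurable" "X \<in> lmeasurable" "X \<subseteq> \<Omega>"
  shows "bdd_meas \<Omega> (character_on X l)"
proof (rule bdd_measI[OF _ norm_character_on_le])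
  have "character l \<in> borel_measurable (lebesgue_on X)" by (rule cis_inner_measurable_lebesgue_on)
  then have "(\<lambda>x. if x \<in> X then character l x else 0) \<in> borel_measurable lebesgue"
    using borel_measurable_if[of X "character l"] assms(2) by (simp add: fmeasurableD)
  then show "character_on X l \<in> borel_measurable (lebesgue_on \<Omega>)"
    unfolding character_on_def[abs_def] by (rule measurable_restrict_space1)
qed

lemma L2_inner_eq_ft:
  assumes \<Omega>: "\<Omega> \<in> lmeasurable" and X: "X \<in> lmeasurable" "X \<subseteq> \<Omega>"
    and eq: "\<And>x. x \<in> \<Omega> \<Longrightarrow> f x * cnj (g x) = character_on X \<xi> x"
  shows "L2_inner \<Omega> f g = ft X \<xi>"
proof -
  have "L2_inner \<Omega> f g = (LINT x|lebesgue_on \<Omega>. character_on X \<xi> x)"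
    unfolding L2_inner_def by (intro Bochner_Integration.integral_cong) (auto simp: eq)
  also have "\<dots> = integral \<Omega> (character_on X \<xi>)"
    using \<Omega> X by (intro lebesgue_integral_eq_integral bdd_meas_integrable bdd_meas_character_on) auto
  also have "(character_on X \<xi> has_integral ft X \<xi>) \<Omega>"
    unfolding character_on_def[abs_def] has_integral_restrict[OF X(2)] by (rule has_integral_ft[OF X(1)])
  then have "integral \<Omega> (character_on X \<xi>) = ft X \<xi>" by (rule integral_unique)
  finally show ?thesis .
qed

lemma L2_inner_characters:
  assumes "\<Omega> \<in> lmeasurable"
  shows "L2_inner \<Omega> (character l) (character m) = ft \<Omega> (l - m)"
  by (rule L2_inner_eq_ft) (use assms in \<open>auto simp: character_on_def cis_cnj cis_mult inner_diff_left algebra_simps\<close>)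

context
  fixes \<Omega> X :: "'a::euclidean_space set"
  assumes \<Omega>: "\<Omega> \<in> lmeasurable" and X: "X \<in> lmeasurable" "X \<subseteq> \<Omega>"
begin

lemma L2_inner_character_on:
  "L2_inner \<Omega> (character_on X l) (character m) = ft X (l - m)"
  "L2_inner \<Omega> (character m) (character_on X l) = cnj (ft X (l - m))"
  "L2_inner \<Omega> (character_on X l) (character_on X m) = ft X (l - m)"
proof -
  show 1: "L2_inner \<Omega> (character_on X l) (character m) = ft X (l - m)"
    by (rule L2_inner_eq_ft[OF \<Omega> X]) (auto simp: character_on_def cis_cnj cis_mult inner_diff_left algebra_simps)
  show "L2_inner \<Omega> (character m) (character_on X l) = cnj (ft X (l - m))"
    unfolding 1[symmetric] by (rule L2_inner_commute[OF \<Omega>])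
  show "L2_inner \<Omega> (character_on X l) (character_on X m) = ft X (l - m)"
    by (rule L2_inner_eq_ft[OF \<Omega> X]) (auto simp: character_on_def cis_cnj cis_mult inner_diff_left algebra_simps)
qed

lemma L2_norm_character_on: "(L2_norm \<Omega> (character_on X l))\<^sup>2 = measure lebesgue X"
  using L2_norm_eq(1)[of \<Omega> "character_on X l"] \<Omega> by (simp add: L2_inner_character_on ft_zero X)

end

locale spectrum =
  fixes \<Omega> \<Lambda> :: "'a::euclidean_space set"
  assumes \<Omega>: "\<Omega> \<in> lmeasurable" "0 < measure lebesgue \<Omega>"
    and basis: "orthogonal_basis_L2 \<Omega> \<Lambda> character"
begin

lemma ft_eq_0: "l \<in> \<Lambda> \<Longrightarrow> m \<in> \<Lambda> \<Longrightarrow> l \<noteq> m \<Longrightarrow> ft \<Omega> (l - m) = 0"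
  using basis unfolding orthogonal_basis_L2_def L2_inner_characters[OF \<Omega>(1)] by blast

lemma bessel_ft:
  assumes "finite S" "S \<subseteq> \<Lambda>" "X \<in> lmeasurable" "X \<subseteq> \<Omega>"
  shows "(\<Sum>\<nu>\<in>S. (norm (ft X (y - \<nu>)))\<^sup>2) \<le> measure lebesgue \<Omega> * measure lebesgue X"
proof -
  have "(\<Sum>\<nu>\<in>S. (norm (L2_inner \<Omega> (character_on X y) (character \<nu>)))\<^sup>2)
      \<le> measure lebesgue \<Omega> * (L2_norm \<Omega> (character_on X y))\<^sup>2"
  proof (rule bessel[OF \<Omega>(1) bdd_meas_character bdd_meas_character_on[OF \<Omega>(1) assms(3,4)] assms(1) _ \<Omega>(2)])
    fix l m assume "l \<in> S" "m \<in> S"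
    then show "L2_inner \<Omega> (character l) (character m) = (if l = m then complex_of_real (measure lebesgue \<Omega>) else 0)"
      using ft_eq_0 assms(2) by (auto simp: L2_inner_characters \<Omega> ft_zero)
  qed
  then show ?thesis
    by (simp only: L2_inner_character_on[OF \<Omega>(1) assms(3,4)] L2_norm_character_on[OF \<Omega>(1) assms(3,4)])
qed

lemma parseval_ft:
  assumes "X \<in> lmeasurable" "X \<subseteq> \<Omega>" "0 < \<epsilon>"
  obtains S where "finite S" "S \<subseteq> \<Lambda>"
    "norm (measure lebesgue \<Omega> * ft X (y - z) - (\<Sum>\<nu>\<in>S. ft X (y - \<nu>) * cnj (ft X (z - \<nu>)))) \<le> \<epsilon>"
proof -
  have "L2_inner \<Omega> (character l) (character l) = complex_of_real (measure lebesgue \<Omega>)" for l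
    by (simp add: L2_inner_characters \<Omega> ft_zero)
  from parseval_approx[OF \<Omega>(1) basis bdd_meas_character this \<Omega>(2) bdd_meas_character_on[OF \<Omega>(1) assms(1,2)]
      bdd_meas_character_on[OF \<Omega>(1) assms(1,2)] norm_character_on_le assms(3), of y z] that
  show ?thesis unfolding L2_inner_character_on[OF \<Omega>(1) assms(1,2)] by blast
qed

text \<open>A small piece \<open>X\<close> of \<open>U\<close> near the origin has a transform of
  modulus at least half its measure at all frequencies of norm at most \<open>r\<close>. Each point
  counted thus contributes a fixed amount to Bessel's sum for \<open>X\<close>, whose bound does not
  depend on \<open>y\<close>.\<close>

lemma card_spectrum_ball_le:
  assumes U: "open U" "U \<subseteq> \<Omega>" "0 \<in> closure U" and r: "0 < r"
  obtains K where "\<And>y S. finite S \<Longrightarrow> S \<subseteq> \<Lambda> \<Longrightarrow> (\<And>\<nu>. \<nu> \<in> S \<Longrightarrow> norm (y - \<nu>) \<le> r) \<Longrightarrow> real (card S) \<le> K"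
proof -
  \<comment> \<open>On \<open>ball 0 \<rho>\<close> the phase of a frequency of norm at most
    \<open>r\<close> is at most \<open>2 * pi * r * \<rho> = 1 / 2\<close> in modulus.\<close>
  define \<rho> where "\<rho> = 1 / (4 * pi * r)"
  have \<rho>: "\<rho> > 0" using r by (simp add: \<rho>_def)
  define X where "X = U \<inter> ball 0 \<rho>"
  define m where "m = measure lebesgue X"
  have "open X" unfolding X_def using U(1) by auto
  moreover have "X \<noteq> {}"
  proof -
    obtain u where "u \<in> U" "dist u 0 < \<rho>" using U(3) \<rho> unfolding closure_approachable by blast
    then show ?thesis unfolding X_def by (auto simp: dist_commute)
  qed
  moreover have lX: "X \<in> lmeasurable"
    using \<open>open X\<close> unfolding X_def by (intro lmeasurable_open) auto
  ultimately have m: "m > 0"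
    using open_not_negligible[of X] negligible_iff_measure[of X] by (auto simp: m_def zero_less_measure_iff)
  have XU: "X \<subseteq> \<Omega>" using U(2) by (auto simp: X_def)
  have lower: "m / 2 \<le> norm (ft X \<xi>)" if \<xi>: "norm \<xi> \<le> r" for \<xi>
  proof -
    have "norm (integral X (\<lambda>x. character \<xi> x - character 0 x)) \<le> integral X (\<lambda>x. 1 / 2)"
    proof (intro integral_norm_bound_integral integrable_diff integrable_cis_inner integrable_on_const lX)
      fix x assume "x \<in> X"
      then have x: "norm x \<le> \<rho>" by (simp add: X_def)
      have "norm (character \<xi> x - character 0 x) \<le> \<bar>2 * pi * (\<xi> \<bullet> x) - 2 * pi * (0 \<bullet> x)\<bar>"
        by (rule cis_diff_bound)
      also have "\<dots> = 2 * pi * \<bar>\<xi> \<bullet> x\<bar>" by (simp add: abs_mult)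
      also have "\<dots> \<le> 2 * pi * (norm \<xi> * norm x)" by (simp add: Cauchy_Schwarz_ineq2)
      also have "\<dots> \<le> 2 * pi * (r * \<rho>)" using \<xi> x r by (intro mult_left_mono mult_mono) auto
      also have "\<dots> = 1 / 2" using r by (simp add: \<rho>_def)
      finally show "norm (character \<xi> x - character 0 x) \<le> 1 / 2" .
    qed
    also have "\<dots> = m / 2"
      using integral_mult_right[of X "1/2" "\<lambda>_. 1::real"] lmeasure_integral[OF lX] by (simp add: m_def)
    finally have "norm (ft X \<xi> - ft X 0) \<le> m / 2"
      by (simp add: ft_def integral_diff integrable_cis_inner[OF lX] integrable_on_const[OF lX])
    moreover have "norm (ft X 0) = m" using m by (simp add: ft_zero lX m_def)
    ultimately show ?thesis using norm_triangle_ineq2[of "ft X 0" "ft X \<xi>"] by (simp add: norm_minus_commute)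
  qed
  show ?thesis
  proof (rule that[of "4 * measure lebesgue \<Omega> / m"])
    fix y S assume S: "finite S" "S \<subseteq> \<Lambda>" "\<And>\<nu>. \<nu> \<in> S \<Longrightarrow> norm (y - \<nu>) \<le> r"
    have "real (card S) * (m / 2)\<^sup>2 = (\<Sum>\<nu>\<in>S. (m / 2)\<^sup>2)" by simp
    also have "\<dots> \<le> (\<Sum>\<nu>\<in>S. (norm (ft X (y - \<nu>)))\<^sup>2)"
      using S(3) lower m by (intro sum_mono power_mono) auto
    also have "\<dots> \<le> measure lebesgue \<Omega> * m"
      unfolding m_def by (rule bessel_ft[OF S(1,2) lX XU])
    finally show "real (card S) \<le> 4 * measure lebesgue \<Omega> / m"
      using m by (simp add: field_simps power2_eq_square)
  qed
qed

end

subsection \<open>Sets containing the unit cube\<close>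

definition unit_cube :: "(real^'d) set" where
  "unit_cube = {x. \<forall>k. 0 < x $ k \<and> x $ k < 1}"

lemma unit_cube_eq_box: "unit_cube = box 0 (\<chi> k. 1)"
  by (auto simp: unit_cube_def mem_box_cart)

lemma unit_cube_lmeasurable [simp]: "unit_cube \<in> lmeasurable"
  by (simp add: unit_cube_eq_box)

lemma ft_unit_cube: "ft unit_cube = ft (slab j 0 1)"
proof -
  have "slab j 0 1 = cbox 0 (\<chi> k. 1)" unfolding slab_def zero_vec_def by (simp cong: if_cong)
  then show ?thesis by (simp add: unit_cube_eq_box ft_box)
qed

lemma measure_unit_cube: "measure lebesgue (unit_cube :: (real^'d) set) = 1"
proof -
  have "complex_of_real (measure lebesgue (unit_cube :: (real^'d) set)) =
      complex_of_real (measure lebesgue (slab undefined 0 1 :: (real^'d) set))"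
    unfolding ft_zero[OF unit_cube_lmeasurable, symmetric] ft_zero[OF slab_lmeasurable(1), symmetric]
    by (simp only: ft_unit_cube[of undefined])
  then show ?thesis by (simp add: measure_slab)
qed

locale spectrum_cube = spectrum \<Omega> \<Lambda> for \<Omega> \<Lambda> :: "(real^'d) set" +
  assumes cube: "unit_cube \<subseteq> \<Omega>"
begin

abbreviation "A \<equiv> measure lebesgue \<Omega>"

text \<open>Multiplied by \<open>\<bar>1 - cis (2 * pi * t * \<xi> $ j)\<bar>\<close>, the transform of the cube is dominated by that of a
  slab of width \<open>t\<close>, to which Bessel's inequality applies; averaging over \<open>t\<close> gives the tail bound.\<close>
lemma bessel_tail_coordinate:
  assumes S: "finite S" "S \<subseteq> \<Lambda>" and R: "1 < R" and far: "\<And>\<nu>. \<nu> \<in> S \<Longrightarrow> R \<le> \<bar>(y - \<nu>) $ j\<bar>"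
  shows "(\<Sum>\<nu>\<in>S. (norm (ft unit_cube (y - \<nu>)))\<^sup>2) \<le> 2 * A / R"
proof -
  define F where "F \<nu> = (norm (ft unit_cube (y - \<nu>)))\<^sup>2" for \<nu>
  define x where "x \<nu> = (y - \<nu>) $ j" for \<nu>
  have x0: "x \<nu> \<noteq> 0" if "\<nu> \<in> S" for \<nu> using far[OF that] R unfolding x_def by auto
  have main: "(\<Sum>\<nu>\<in>S. F \<nu> * (2 - 2 * cos (2 * pi * t * x \<nu>))) \<le> 4 * A * t" if t: "0 \<le> t" "t < 1" for t
  proof (cases "t = 0")
    case False
    with t have t: "0 < t" "t < 1" by auto
    \<comment> \<open>An open box, so that it fits into the open cube; its corners are written as in
      \<open>slab\<close>, whose transform it shares.\<close>
    define X where "X = box (\<chi> k. if k = j then 0 else 0) (\<chi> k. if k = j then t else 1)"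
    have X: "X \<in> lmeasurable" "X \<subseteq> \<Omega>" "ft X = ft (slab j 0 t)"
    proof -
      show "ft X = ft (slab j 0 t)" unfolding X_def slab_def by (rule ft_box)
      have "X \<subseteq> unit_cube"
      proof
        fix x assume "x \<in> X"
        then have "\<forall>k. 0 < x $ k \<and> x $ k < (if k = j then t else 1)"
          by (simp add: X_def mem_box_cart)
        moreover have "(if k = j then t else 1) \<le> 1" for k using t by simp
        ultimately show "x \<in> unit_cube" unfolding unit_cube_def by (blast intro: less_le_trans)
      qed
      then show "X \<subseteq> \<Omega>" using cube by blast
    qed (simp add: X_def)
    have "measure lebesgue X = t"
      using ft_zero[OF X(1)] ft_zero[of "slab j 0 t"] X(3) t by (simp add: measure_slab)
    then have B: "(\<Sum>\<nu>\<in>S. (norm (ft (slab j 0 t) (y - \<nu>)))\<^sup>2) \<le> A * t"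
      using bessel_ft[OF S X(1,2), of y] X(3) by simp
    have "F \<nu> * (2 - 2 * cos (2 * pi * t * x \<nu>)) \<le> 4 * (norm (ft (slab j 0 t) (y - \<nu>)))\<^sup>2" for \<nu>
    proof -
      have "(norm (1 - cis a))\<^sup>2 = 2 - 2 * cos a" for a
        by (simp add: cmod_power2 power2_diff sin_squared_eq)
      then have "F \<nu> * (2 - 2 * cos (2 * pi * t * x \<nu>)) = (norm ((1 - cis (2 * pi * t * x \<nu>)) * ft (slab j 0 1) (y - \<nu>)))\<^sup>2"
        unfolding F_def ft_unit_cube[of j] norm_mult power_mult_distrib by simp
      also have "\<dots> = (norm (1 - cis (2 * pi * x \<nu>)))\<^sup>2 * (norm (ft (slab j 0 t) (y - \<nu>)))\<^sup>2"
        unfolding x_def ft_slab_eq[OF t] norm_mult power_mult_distrib ..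
      also have "\<dots> \<le> 2\<^sup>2 * (norm (ft (slab j 0 t) (y - \<nu>)))\<^sup>2"
        using norm_triangle_ineq4[of 1 "cis (2 * pi * x \<nu>)"] by (intro mult_right_mono power_mono) auto
      finally show ?thesis by simp
    qed
    then have "(\<Sum>\<nu>\<in>S. F \<nu> * (2 - 2 * cos (2 * pi * t * x \<nu>))) \<le> (\<Sum>\<nu>\<in>S. 4 * (norm (ft (slab j 0 t) (y - \<nu>)))\<^sup>2)"
      by (rule sum_mono)
    also have "\<dots> \<le> 4 * (A * t)" using B by (simp flip: sum_distrib_left)
    finally show ?thesis by simp
  qed simp
  \<comment> \<open>This function vanishes at 0 and its derivative is the nonnegative gap in
    \<open>main\<close>; comparing its values at 0 and \<open>1 / R\<close> integrates that
    inequality over \<open>t\<close>.\<close>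
  define \<Phi> where "\<Phi> t = 2 * A * t\<^sup>2 - (\<Sum>\<nu>\<in>S. F \<nu> * (2 * t - sin (2 * pi * t * x \<nu>) / (pi * x \<nu>)))" for t
  have "\<Phi> 0 \<le> \<Phi> (1 / R)"
  proof (rule DERIV_nonneg_imp_nondecreasing[where f=\<Phi> and a=0 and b="1 / R"])
    show "0 \<le> 1 / R" using R by auto
    fix t assume t: "0 \<le> t" "t \<le> 1 / R"
    have "(\<Phi> has_real_derivative 4 * A * t - (\<Sum>\<nu>\<in>S. F \<nu> * (2 - 2 * cos (2 * pi * t * x \<nu>)))) (at t)"
      unfolding \<Phi>_def
      by (intro derivative_eq_intros DERIV_sum DERIV_cmult) (auto intro!: derivative_eq_intros sum.cong dest!: x0)
    moreover have "1 / R < 1" using R by simp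
    then have "t < 1" using t by linarith
    ultimately show "\<exists>d. (\<Phi> has_real_derivative d) (at t) \<and> 0 \<le> d" using main t by fastforce
  qed
  then have "(\<Sum>\<nu>\<in>S. F \<nu> * (2 * (1 / R) - sin (2 * pi * (1 / R) * x \<nu>) / (pi * x \<nu>))) \<le> 2 * A * (1 / R)\<^sup>2"
    by (simp add: \<Phi>_def)
  \<comment> \<open>Since \<open>R \<le> \<bar>x \<nu>\<bar>\<close>, the sine term is at most
    \<open>1 / R\<close> in modulus and leaves at least half of \<open>2 * (1 / R)\<close>.\<close>
  moreover have "(\<Sum>\<nu>\<in>S. F \<nu> * (1 / R)) \<le> (\<Sum>\<nu>\<in>S. F \<nu> * (2 * (1 / R) - sin (2 * pi * (1 / R) * x \<nu>) / (pi * x \<nu>)))"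
  proof (intro sum_mono mult_left_mono)
    fix \<nu> assume \<nu>: "\<nu> \<in> S"
    have "\<bar>sin (2 * pi * (1 / R) * x \<nu>) / (pi * x \<nu>)\<bar> \<le> 1 / \<bar>pi * x \<nu>\<bar>"
      unfolding abs_divide by (intro divide_right_mono) auto
    also have "\<dots> \<le> 1 / R"
    proof (intro divide_left_mono)
      have "R \<le> 1 * \<bar>x \<nu>\<bar>" using far[OF \<nu>] by (simp add: x_def)
      also have "\<dots> \<le> pi * \<bar>x \<nu>\<bar>" using pi_gt3 by (intro mult_right_mono) auto
      finally show "R \<le> \<bar>pi * x \<nu>\<bar>" by (simp add: abs_mult)
    qed (use R x0[OF \<nu>] in auto)
    finally show "1 / R \<le> 2 * (1 / R) - sin (2 * pi * (1 / R) * x \<nu>) / (pi * x \<nu>)" by linarith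
  qed (simp add: F_def)
  ultimately have "(\<Sum>\<nu>\<in>S. F \<nu>) * (1 / R) \<le> 2 * A * (1 / R)\<^sup>2"
    unfolding sum_distrib_right by linarith
  then show ?thesis using R by (simp add: F_def field_simps power2_eq_square)
qed

text \<open>Each \<open>\<nu>\<close> is charged to every coordinate in which it is far from
  \<open>y\<close>; summing over the coordinates costs the factor \<open>CARD('d)\<close>.\<close>

lemma bessel_tail:
  assumes S: "finite S" "S \<subseteq> \<Lambda>" and R: "1 < R" and far: "\<And>\<nu>. \<nu> \<in> S \<Longrightarrow> \<exists>k. R \<le> \<bar>(y - \<nu>) $ k\<bar>"
  shows "(\<Sum>\<nu>\<in>S. (norm (ft unit_cube (y - \<nu>)))\<^sup>2) \<le> CARD('d) * (2 * A / R)"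
proof -
  let ?F = "\<lambda>\<nu>. (norm (ft unit_cube (y - \<nu>)))\<^sup>2"
  have "(\<Sum>\<nu>\<in>S. ?F \<nu>) \<le> (\<Sum>\<nu>\<in>S. \<Sum>k\<in>UNIV. if R \<le> \<bar>(y - \<nu>) $ k\<bar> then ?F \<nu> else 0)"
  proof (rule sum_mono)
    fix \<nu> assume "\<nu> \<in> S"
    then obtain k where "R \<le> \<bar>(y - \<nu>) $ k\<bar>" using far by blast
    then show "?F \<nu> \<le> (\<Sum>k\<in>UNIV. if R \<le> \<bar>(y - \<nu>) $ k\<bar> then ?F \<nu> else 0)"
      using member_le_sum[of k UNIV "\<lambda>k. if R \<le> \<bar>(y - \<nu>) $ k\<bar> then ?F \<nu> else 0"] by simp
  qed
  also have "\<dots> = (\<Sum>k\<in>UNIV. \<Sum>\<nu>\<in>S. if R \<le> \<bar>(y - \<nu>) $ k\<bar> then ?F \<nu> else 0)" by (rule sum.swap)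
  also have "\<dots> = (\<Sum>k\<in>UNIV. \<Sum>\<nu>\<in>{\<nu>\<in>S. R \<le> \<bar>(y - \<nu>) $ k\<bar>}. ?F \<nu>)"
    using S(1) by (simp add: sum.inter_filter)
  also have "\<dots> \<le> (\<Sum>k\<in>(UNIV::'d set). 2 * A / R)"
    using S R by (intro sum_mono bessel_tail_coordinate[where R=R]) auto
  finally show ?thesis by simp
qed

text \<open>By Cauchy-Schwarz it is enough that one factor has a small tail; the other is controlled
  by Bessel's inequality for the whole cube.\<close>

lemma tail_product:
  assumes S: "finite S" "S \<subseteq> \<Lambda>" and R: "1 < R" and far: "\<And>\<nu>. \<nu> \<in> S \<Longrightarrow> \<exists>k. R \<le> \<bar>(y - \<nu>) $ k\<bar>"
    and \<epsilon>: "0 < \<epsilon>" "2 * CARD('d) * A\<^sup>2 / \<epsilon>\<^sup>2 \<le> R"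
  shows "(\<Sum>\<nu>\<in>S. norm (ft unit_cube (y - \<nu>)) * norm (ft unit_cube (z - \<nu>))) \<le> \<epsilon>"
proof -
  let ?F = "\<lambda>y \<nu>. norm (ft unit_cube (y - \<nu>))"
  have "(\<Sum>\<nu>\<in>S. ?F y \<nu> * ?F z \<nu>) \<le> L2_set (?F y) S * L2_set (?F z) S"
    using L2_set_mult_ineq[of "?F y" "?F z" S] by simp
  also have "\<dots> = sqrt ((\<Sum>\<nu>\<in>S. (?F y \<nu>)\<^sup>2) * (\<Sum>\<nu>\<in>S. (?F z \<nu>)\<^sup>2))"
    by (simp add: L2_set_def real_sqrt_mult)
  also have "\<dots> \<le> sqrt ((CARD('d) * (2 * A / R)) * (A * 1))"
    using bessel_tail[OF S R far] bessel_ft[OF S unit_cube_lmeasurable cube, of z] R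
    unfolding measure_unit_cube by (intro real_sqrt_le_mono mult_mono) (auto intro: sum_nonneg)
  also have "\<dots> \<le> sqrt (\<epsilon>\<^sup>2)"
    using R \<epsilon> by (intro real_sqrt_le_mono) (simp add: field_simps power2_eq_square)
  finally show ?thesis using \<epsilon> by simp
qed

text \<open>The shape of \<open>\<Omega>\<close> outside the cube enters only through
  \<open>decay\<close>, which concerns zeros of \<open>ft \<Omega>\<close>; differences of distinct
  points of the spectrum are such zeros. Shifting \<open>l\<close> and \<open>m\<close> alike keeps
  \<open>l - m\<close>, but makes the points that matter in Parseval's sum distant from both in
  direction \<open>j\<close>.\<close>

lemma ft_unit_cube_eq_0:
  assumes decay: "\<And>j M \<epsilon>. 0 < \<epsilon> \<Longrightarrow> \<exists>T. \<forall>\<xi>. T \<le> \<bar>\<xi> $ j\<bar> \<longrightarrow> (\<forall>k. k \<noteq> j \<longrightarrow> \<bar>\<xi> $ k\<bar> \<le> M) \<longrightarrow>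
      ft \<Omega> \<xi> = 0 \<longrightarrow> \<bar>\<xi> $ j\<bar> * norm (ft unit_cube \<xi>) \<le> \<epsilon>"
    and l: "l \<in> \<Lambda>" and m: "m \<in> \<Lambda>" and "l \<noteq> m"
  shows "ft unit_cube (l - m) = 0"
proof -
  let ?F = "ft unit_cube"
  obtain j where j: "l $ j \<noteq> m $ j" using \<open>l \<noteq> m\<close> by (auto simp: vec_eq_iff)
  define \<delta> where "\<delta> = \<bar>l $ j - m $ j\<bar>"
  have \<delta>: "\<delta> > 0" using j by (simp add: \<delta>_def)
  \<comment> \<open>The four errors come from Parseval's identity, the tails around \<open>y\<close>
    and \<open>z\<close>, and the near terms.\<close>
  have bound: "A * norm (?F (l - m)) \<le> 0 + 4 * \<epsilon>" if \<epsilon>: "\<epsilon> > 0" for \<epsilon>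
  proof -
    define R where "R = 2 + 2 * CARD('d) * A\<^sup>2 / \<epsilon>\<^sup>2"
    have R: "1 < R" "2 * CARD('d) * A\<^sup>2 / \<epsilon>\<^sup>2 \<le> R" using \<epsilon> by (auto simp: R_def add_pos_nonneg)
    have "open (unit_cube :: (real^'d) set)" by (simp add: unit_cube_eq_box open_box)
    moreover have "0 \<in> closure (unit_cube :: (real^'d) set)"
      unfolding unit_cube_eq_box by (subst closure_box) (auto simp: interval_ne_empty_cart mem_box_cart)
    \<comment> \<open>A vector with all coordinates at most \<open>R\<close> in modulus has norm at
      most \<open>CARD('d) * R\<close>, so this radius captures the near terms.\<close>
    moreover have "0 < CARD('d) * R" using R(1) by simp
    ultimately obtain K where K: "\<And>y S. finite S \<Longrightarrow> S \<subseteq> \<Lambda> \<Longrightarrow> (\<And>\<nu>. \<nu> \<in> S \<Longrightarrow> norm (y - \<nu>) \<le> CARD('d) * R) \<Longrightarrow> real (card S) \<le> K"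
      using card_spectrum_ball_le[OF _ cube] by blast
    have K0: "0 \<le> K" using K[of "{}"] by simp
    \<comment> \<open>At most \<open>K\<close> near terms of size
      \<open>2 * \<eta> / \<delta>\<close> then add up to at most \<open>\<epsilon>\<close>;
      \<open>K + 1\<close> excludes a zero denominator.\<close>
    define \<eta> where "\<eta> = \<epsilon> * \<delta> / (2 * (K + 1))"
    have \<eta>: "\<eta> > 0" using \<epsilon> \<delta> K0 by (simp add: \<eta>_def)
    obtain T where T: "\<And>\<xi>. T \<le> \<bar>\<xi> $ j\<bar> \<Longrightarrow> (\<And>k. k \<noteq> j \<Longrightarrow> \<bar>\<xi> $ k\<bar> \<le> R) \<Longrightarrow>
      ft \<Omega> \<xi> = 0 \<Longrightarrow> \<bar>\<xi> $ j\<bar> * norm (?F \<xi>) \<le> \<eta>"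
      using decay[OF \<eta>, of j R] by blast
    obtain s :: nat where s: "\<bar>T\<bar> + R + 1 < s" using reals_Archimedean2 by blast
    define y z where "y = l + axis j (real s)" and "z = m + axis j (real s)"
    have near: "\<bar>(p + axis j (real s) - \<nu>) $ j\<bar> * norm (?F (p + axis j (real s) - \<nu>)) \<le> \<eta>"
      if p: "p \<in> \<Lambda>" "\<nu> \<in> \<Lambda>" and pR: "\<And>k. \<bar>(p + axis j (real s) - \<nu>) $ k\<bar> < R" for p \<nu>
    proof -
      define \<xi> where "\<xi> = p - \<nu>"
      have eq: "p + axis j (real s) - \<nu> = \<xi> + axis j (real s)" by (simp add: \<xi>_def)
      \<comment> \<open>The shifted coordinate is below \<open>R\<close> in modulus while
        \<open>s\<close> exceeds \<open>\<bar>T\<bar> + R + 1\<close>, so the unshifted one is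
        large; in particular \<open>p \<noteq> \<nu>\<close>.\<close>
      have \<xi>j: "\<bar>T\<bar> + 1 \<le> \<bar>\<xi> $ j\<bar>" using pR[of j] s unfolding eq by (simp add: axis_def)
      have "\<bar>\<xi> $ k\<bar> \<le> R" if "k \<noteq> j" for k
        using pR[of k] that unfolding eq by (simp add: axis_def)
      moreover have "ft \<Omega> \<xi> = 0" using \<xi>j p unfolding \<xi>_def by (intro ft_eq_0) auto
      ultimately have "\<bar>\<xi> $ j\<bar> * norm (?F \<xi>) \<le> \<eta>" using \<xi>j by (intro T) auto
      moreover have "norm (complex_of_real (\<xi> $ j + s) * ?F (\<xi> + axis j (real s))) = norm (complex_of_real (\<xi> $ j) * ?F \<xi>)"
        using ft_slab_int_shift[of "real s" \<xi> j] unfolding ft_unit_cube[of j] by simp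
      ultimately show ?thesis unfolding eq by (simp only: norm_mult norm_of_real) (simp add: axis_def)
    qed
    obtain S where S: "finite S" "S \<subseteq> \<Lambda>"
      "norm (A * ?F (y - z) - (\<Sum>\<nu>\<in>S. ?F (y - \<nu>) * cnj (?F (z - \<nu>)))) \<le> \<epsilon>"
      using parseval_ft[OF unit_cube_lmeasurable cube \<epsilon>] .
    define h where "h \<nu> = norm (?F (y - \<nu>)) * norm (?F (z - \<nu>))" for \<nu>
    define Sy Sz N where "Sy = {\<nu>\<in>S. \<exists>k. R \<le> \<bar>(y - \<nu>) $ k\<bar>}" and "Sz = {\<nu>\<in>S. \<exists>k. R \<le> \<bar>(z - \<nu>) $ k\<bar>}"
      and "N = {\<nu>\<in>S. (\<forall>k. \<bar>(y - \<nu>) $ k\<bar> < R) \<and> (\<forall>k. \<bar>(z - \<nu>) $ k\<bar> < R)}"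
    have y_tail: "sum h Sy \<le> \<epsilon>"
      unfolding h_def using S by (intro tail_product[OF _ _ R(1) _ \<epsilon> R(2)]) (auto simp: Sy_def)
    have "sum h Sz = (\<Sum>\<nu>\<in>Sz. norm (?F (z - \<nu>)) * norm (?F (y - \<nu>)))"
      unfolding h_def by (simp add: mult.commute)
    also have "\<dots> \<le> \<epsilon>"
      using S by (intro tail_product[OF _ _ R(1) _ \<epsilon> R(2)]) (auto simp: Sz_def)
    finally have z_tail: "sum h Sz \<le> \<epsilon>" .
    have hN: "h \<nu> \<le> 2 * \<eta> / \<delta>" if "\<nu> \<in> N" for \<nu>
    proof -
      have \<nu>: "\<nu> \<in> \<Lambda>" "\<And>k. \<bar>(y - \<nu>) $ k\<bar> < R" "\<And>k. \<bar>(z - \<nu>) $ k\<bar> < R"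
        using that S(2) by (auto simp: N_def)
      have a: "\<bar>(y - \<nu>) $ j\<bar> * norm (?F (y - \<nu>)) \<le> \<eta>" and b: "\<bar>(z - \<nu>) $ j\<bar> * norm (?F (z - \<nu>)) \<le> \<eta>"
        using near[OF l \<nu>(1)] near[OF m \<nu>(1)] \<nu> unfolding y_def z_def by auto
      have F1: "norm (?F \<xi>) \<le> 1" for \<xi> :: "real^'d"
        using norm_ft_le[of unit_cube \<xi>] by (simp add: measure_unit_cube)
      \<comment> \<open>The two \<open>j\<close>-th coordinates differ by \<open>\<delta>\<close>,
        so one of them is at least \<open>\<delta> / 2\<close> in modulus. Its factor is then small,
        and the other factor is at most 1.\<close>
      have "\<delta> = \<bar>(y - \<nu>) $ j - (z - \<nu>) $ j\<bar>" by (simp add: y_def z_def \<delta>_def)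
      then consider "\<delta> / 2 \<le> \<bar>(y - \<nu>) $ j\<bar>" | "\<delta> / 2 \<le> \<bar>(z - \<nu>) $ j\<bar>" by linarith
      then have "\<delta> / 2 * h \<nu> \<le> \<eta>"
      proof cases
        case 1
        have "\<delta> / 2 * h \<nu> = (\<delta> / 2 * norm (?F (y - \<nu>))) * norm (?F (z - \<nu>))" by (simp add: h_def)
        also have "\<dots> \<le> (\<bar>(y - \<nu>) $ j\<bar> * norm (?F (y - \<nu>))) * 1"
          using 1 F1 \<delta> by (intro mult_mono) auto
        finally show ?thesis using a by simp
      next
        case 2
        have "\<delta> / 2 * h \<nu> = (\<delta> / 2 * norm (?F (z - \<nu>))) * norm (?F (y - \<nu>))" by (simp add: h_def)
        also have "\<dots> \<le> (\<bar>(z - \<nu>) $ j\<bar> * norm (?F (z - \<nu>))) * 1"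
          using 2 F1 \<delta> by (intro mult_mono) auto
        finally show ?thesis using b by simp
      qed
      then show ?thesis using \<delta> by (simp add: field_simps)
    qed
    have "real (card N) \<le> K"
    proof (rule K)
      fix \<nu> assume "\<nu> \<in> N"
      then have "norm (y - \<nu>) \<le> (\<Sum>k\<in>(UNIV::'d set). R)"
        using norm_le_l1_cart[of "y - \<nu>"] by (intro order.trans[OF norm_le_l1_cart] sum_mono) (auto simp: N_def less_imp_le)
      then show "norm (y - \<nu>) \<le> CARD('d) * R" by simp
    qed (use S in \<open>auto simp: N_def\<close>)
    then have "card N * (2 * \<eta> / \<delta>) \<le> K * (2 * \<eta> / \<delta>)"
      using \<eta> \<delta> by (intro mult_right_mono) auto
    moreover have "sum h N \<le> card N * (2 * \<eta> / \<delta>)" using hN by (rule sum_bounded_above)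
    ultimately have "sum h N \<le> K * (2 * \<eta> / \<delta>)" by linarith
    also have "\<dots> = \<epsilon> * (K / (K + 1))"
    proof -
      have *: "K * (2 * (\<epsilon> * \<delta> / (2 * c)) / \<delta>) = \<epsilon> * (K / c)" if "c \<noteq> 0" for c
        using \<delta> that by (simp add: field_simps)
      have "K + 1 \<noteq> 0" using K0 by simp
      from *[OF this] show ?thesis unfolding \<eta>_def .
    qed
    also have "\<dots> \<le> \<epsilon>" using K0 \<epsilon> by (intro mult_left_le) auto
    finally have N: "sum h N \<le> \<epsilon>" .
    \<comment> \<open>The sets \<open>Sy\<close> and \<open>Sz\<close> cover \<open>S\<close>
      together with \<open>N\<close> but may overlap, hence an inequality.\<close>
    have "sum h S \<le> (\<Sum>\<nu>\<in>S. (if \<nu> \<in> Sy then h \<nu> else 0) + ((if \<nu> \<in> Sz then h \<nu> else 0) + (if \<nu> \<in> N then h \<nu> else 0)))"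
    proof (rule sum_mono)
      fix \<nu> assume "\<nu> \<in> S"
      then have "\<nu> \<in> Sy \<or> \<nu> \<in> Sz \<or> \<nu> \<in> N" unfolding Sy_def Sz_def N_def by (auto simp: not_le)
      moreover have "0 \<le> h \<nu>" by (simp add: h_def)
      ultimately show "h \<nu> \<le> (if \<nu> \<in> Sy then h \<nu> else 0) + ((if \<nu> \<in> Sz then h \<nu> else 0) + (if \<nu> \<in> N then h \<nu> else 0))"
        by auto
    qed
    also have "\<dots> = sum h Sy + (sum h Sz + sum h N)"
    proof -
      have "(\<Sum>\<nu>\<in>S. if \<nu> \<in> B then h \<nu> else 0) = sum h B" if "B \<subseteq> S" for B
        using that S(1) by (simp add: sum.inter_restrict[symmetric] Int_absorb1)
      moreover have "Sy \<subseteq> S" "Sz \<subseteq> S" "N \<subseteq> S" by (auto simp: Sy_def Sz_def N_def)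
      ultimately show ?thesis by (simp add: sum.distrib)
    qed
    finally have hS: "sum h S \<le> 3 * \<epsilon>" using y_tail z_tail N by linarith
    have "norm (A * ?F (y - z)) \<le> norm (A * ?F (y - z) - (\<Sum>\<nu>\<in>S. ?F (y - \<nu>) * cnj (?F (z - \<nu>)))) + norm (\<Sum>\<nu>\<in>S. ?F (y - \<nu>) * cnj (?F (z - \<nu>)))"
      by (subst add.commute) (rule norm_triangle_sub)
    also have "norm (\<Sum>\<nu>\<in>S. ?F (y - \<nu>) * cnj (?F (z - \<nu>))) \<le> sum h S"
      unfolding h_def by (intro sum_norm_le) (simp add: norm_mult)
    finally have "norm (A * ?F (y - z)) \<le> 4 * \<epsilon>" using S(3) hS by linarith
    then show ?thesis by (simp add: y_def z_def norm_mult)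
  qed
  have "A * norm (?F (l - m)) \<le> 0 + \<epsilon>" if "\<epsilon> > 0" for \<epsilon>
    using bound[of "\<epsilon> / 4"] that by simp
  then have "A * norm (?F (l - m)) \<le> 0" by (rule field_le_epsilon)
  then show ?thesis using \<Omega>(2) by (simp add: mult_le_0_iff)
qed

text \<open>Parseval's identity with both frequencies at one point \<open>l\<close> of the spectrum:
  the left side is \<open>A\<close>, and on the right only the term \<open>\<nu> = l\<close>, which
  is 1, can survive.\<close>

lemma measure_le_1:
  assumes orth: "\<And>l m. l \<in> \<Lambda> \<Longrightarrow> m \<in> \<Lambda> \<Longrightarrow> l \<noteq> m \<Longrightarrow> ft unit_cube (l - m) = 0"
  shows "A \<le> 1"
proof (rule field_le_epsilon)
  fix \<epsilon> :: real assume \<epsilon>: "0 < \<epsilon>"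
  let ?F = "ft unit_cube"
  \<comment> \<open>If \<open>\<Lambda>\<close> is empty, \<open>l\<close> is arbitrary, but then
    \<open>S\<close> is empty as well and the sum is 0.\<close>
  define l where "l = (SOME l. l \<in> \<Lambda>)"
  obtain S where S: "finite S" "S \<subseteq> \<Lambda>"
    "norm (A * ?F (l - l) - (\<Sum>\<nu>\<in>S. ?F (l - \<nu>) * cnj (?F (l - \<nu>)))) \<le> \<epsilon>"
    using parseval_ft[OF unit_cube_lmeasurable cube \<epsilon>] .
  have "?F (l - \<nu>) = (if \<nu> = l then 1 else 0)" if "\<nu> \<in> S" for \<nu>
  proof -
    have "\<nu> \<in> \<Lambda>" using S that by blast
    then have "l \<in> \<Lambda>" unfolding l_def by (rule someI)
    then show ?thesis using orth \<open>\<nu> \<in> \<Lambda>\<close> by (auto simp: ft_zero measure_unit_cube)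
  qed
  then have "(\<Sum>\<nu>\<in>S. ?F (l - \<nu>) * cnj (?F (l - \<nu>))) = (\<Sum>\<nu>\<in>S. if \<nu> = l then 1 else 0)"
    by (intro sum.cong) auto
  then have "norm (complex_of_real A - (if l \<in> S then 1 else 0)) \<le> \<epsilon>"
    using S(1,3) by (simp add: ft_zero measure_unit_cube cong: if_cong)
  moreover have "complex_of_real A - (if l \<in> S then 1 else 0) = complex_of_real (A - (if l \<in> S then 1 else 0))"
    by simp
  ultimately have "norm (complex_of_real (A - (if l \<in> S then 1 else 0))) \<le> \<epsilon>" by (simp only:)
  then show "A \<le> 1 + \<epsilon>" unfolding norm_of_real by (auto split: if_splits)
qed

end

theorem theorem1p3:
  fixes N :: nat
    and Q \<Omega> :: "(real ^ 'd) set"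
    and P :: "nat \<Rightarrow> (real ^ 'd) set"
  assumes "N \<ge> 1"
    and "Q = {x. \<forall>j. 0 < x $ j \<and> x $ j < 1}"
    and "\<And>i. i \<in> {1..N} \<Longrightarrow> polytope (P i)"
    and "\<And>i. i \<in> {1..N} \<Longrightarrow> measure lebesgue (P i) > 0"
    and "nonoverlapping (insert Q (P ` {1..N}))"
    and "\<Omega> = Q \<union> (\<Union>i\<in>{1..N}. P i)"
    and "\<And>i F u j. i \<in> {1..N} \<Longrightarrow> F facet_of P i \<Longrightarrow> unit_outward_normal (P i) F u
           \<Longrightarrow> u \<noteq> axis j 1 \<and> u \<noteq> - axis j 1"
  shows "\<not> spectral_set \<Omega>"
proof
  assume "spectral_set \<Omega>"
  then obtain \<Lambda> where \<Omega>: "\<Omega> \<in> lmeasurable" "0 < measure lebesgue \<Omega>"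
    and "orthogonal_basis_L2 \<Omega> \<Lambda> (\<lambda>l x. exp (2 * complex_of_real pi * \<i> * complex_of_real (l \<bullet> x)))"
    unfolding spectral_set_def by blast
  moreover have "exp (2 * complex_of_real pi * \<i> * complex_of_real t) = cis (2 * pi * t)" for t
    by (simp add: cis_conv_exp mult_ac)
  ultimately have basis: "orthogonal_basis_L2 \<Omega> \<Lambda> character" by simp
  have Q: "Q = unit_cube" using assms(2) by (simp add: unit_cube_def)
  interpret spectrum_cube \<Omega> \<Lambda>
    by unfold_locales (use \<Omega> basis assms(6) Q in auto)
  \<comment> \<open>Collecting the polytopes in a set merges equal ones, in accordance with
    \<open>nonoverlapping\<close>, which compares distinct sets.\<close>
  define \<P> where "\<P> = P ` {1..N}"
  have \<P>: "finite \<P>" "\<P> \<noteq> {}" using assms(1) by (auto simp: \<P>_def)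
  have poly: "polytope X" "0 < measure lebesgue X" if "X \<in> \<P>" for X
    using that assms(3,4) by (auto simp: \<P>_def)
  have lm: "X \<in> lmeasurable" if "X \<in> \<P>" for X
    using poly(1)[OF that] by (simp add: lmeasurable_compact polytope_imp_compact)
  \<comment> \<open>A polytope is closed, whereas the cube is open, bounded and nonempty. Hence the
    cube is a summand of its own in the transform of the union.\<close>
  have "unit_cube \<notin> \<P>"
  proof
    assume "unit_cube \<in> \<P>"
    then have "closed (unit_cube :: (real^'d) set)" using poly(1) polytope_imp_closed by blast
    moreover have "open (unit_cube :: (real^'d) set)" by (simp add: unit_cube_eq_box open_box)
    moreover have "bounded (unit_cube :: (real^'d) set)" by (simp add: unit_cube_eq_box bounded_box)
    ultimately have "unit_cube = ({} :: (real^'d) set)" using clopen not_bounded_UNIV by metis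
    then have "measure lebesgue (unit_cube :: (real^'d) set) = 0" by (simp only: measure_empty)
    then show False by (simp add: measure_unit_cube)
  qed
  moreover have "ft (\<Union>(insert unit_cube \<P>)) \<xi> = (\<Sum>X\<in>insert unit_cube \<P>. ft X \<xi>)" for \<xi>
    using assms(5) lm \<P>(1) by (intro ft_Union) (auto simp: Q \<P>_def nonoverlapping_def)
  ultimately have ft\<Omega>: "ft \<Omega> \<xi> = ft unit_cube \<xi> + (\<Sum>X\<in>\<P>. ft X \<xi>)" for \<xi>
    using \<P>(1) assms(6) by (simp add: Q \<P>_def)
  \<comment> \<open>Where \<open>ft \<Omega>\<close> vanishes, the transform of the cube is minus
    the sum of those of the polytopes; each of these gets an equal share of
    \<open>\<epsilon>\<close>.\<close>
  have decay: "\<exists>T. \<forall>\<xi>. T \<le> \<bar>\<xi> $ j\<bar> \<longrightarrow> (\<forall>k. k \<noteq> j \<longrightarrow> \<bar>\<xi> $ k\<bar> \<le> M) \<longrightarrow>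
      ft \<Omega> \<xi> = 0 \<longrightarrow> \<bar>\<xi> $ j\<bar> * norm (ft unit_cube \<xi>) \<le> \<epsilon>" if \<epsilon>: "0 < \<epsilon>" for j M \<epsilon>
  proof -
    define \<eta> where "\<eta> = \<epsilon> / card \<P>"
    have \<eta>: "\<eta> > 0" using \<epsilon> \<P> by (simp add: \<eta>_def card_gt_0_iff)
    have "\<exists>T. \<forall>\<xi>. T \<le> \<bar>\<xi> $ j\<bar> \<longrightarrow> (\<forall>k. k \<noteq> j \<longrightarrow> \<bar>\<xi> $ k\<bar> \<le> M) \<longrightarrow> \<bar>\<xi> $ j\<bar> * norm (ft X \<xi>) \<le> \<eta>" if X: "X \<in> \<P>" for X
    proof -
      obtain i where i: "i \<in> {1..N}" "X = P i" using X by (auto simp: \<P>_def)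
      obtain T where "\<And>\<xi>. T \<le> \<bar>\<xi> $ j\<bar> \<Longrightarrow> (\<And>k. k \<noteq> j \<Longrightarrow> \<bar>\<xi> $ k\<bar> \<le> M) \<Longrightarrow> \<bar>\<xi> $ j\<bar> * norm (ft (P i) \<xi>) \<le> \<eta>"
        by (rule ft_polytope_decay[OF assms(3)[OF i(1)] assms(4)[OF i(1)] assms(7)[OF i(1)] \<eta>, where j=j and M=M]) blast+
      then show ?thesis unfolding i by blast
    qed
    then obtain T where T: "\<And>X \<xi>. X \<in> \<P> \<Longrightarrow> T X \<le> \<bar>\<xi> $ j\<bar> \<Longrightarrow> (\<forall>k. k \<noteq> j \<longrightarrow> \<bar>\<xi> $ k\<bar> \<le> M) \<Longrightarrow> \<bar>\<xi> $ j\<bar> * norm (ft X \<xi>) \<le> \<eta>"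
      by metis
    show ?thesis
    proof (intro exI[of _ "Max (T ` \<P>)"] allI impI)
      fix \<xi> assume \<xi>: "Max (T ` \<P>) \<le> \<bar>\<xi> $ j\<bar>" "\<forall>k. k \<noteq> j \<longrightarrow> \<bar>\<xi> $ k\<bar> \<le> M" and "ft \<Omega> \<xi> = 0"
      then have "ft unit_cube \<xi> = - (\<Sum>X\<in>\<P>. ft X \<xi>)" using ft\<Omega>[of \<xi>] by (simp add: eq_neg_iff_add_eq_0)
      then have "norm (ft unit_cube \<xi>) \<le> (\<Sum>X\<in>\<P>. norm (ft X \<xi>))" by (simp add: norm_sum)
      then have "\<bar>\<xi> $ j\<bar> * norm (ft unit_cube \<xi>) \<le> (\<Sum>X\<in>\<P>. \<bar>\<xi> $ j\<bar> * norm (ft X \<xi>))"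
        unfolding sum_distrib_left[symmetric] by (intro mult_left_mono) auto
      also have "\<dots> \<le> (\<Sum>X\<in>\<P>. \<eta>)"
      proof (intro sum_mono T \<xi>(2))
        fix X assume "X \<in> \<P>"
        then have "T X \<le> Max (T ` \<P>)" using \<P>(1) by simp
        with \<xi>(1) show "T X \<le> \<bar>\<xi> $ j\<bar>" by linarith
      qed
      also have "\<dots> = \<epsilon>" using \<P> by (simp add: \<eta>_def)
      finally show "\<bar>\<xi> $ j\<bar> * norm (ft unit_cube \<xi>) \<le> \<epsilon>" .
    qed
  qed
  have "measure lebesgue \<Omega> \<le> 1"
    by (intro measure_le_1 ft_unit_cube_eq_0 decay)
  \<comment> \<open>At frequency 0 the decomposition of the transform becomes additivity of the
    measure.\<close>
  moreover have "complex_of_real (measure lebesgue \<Omega>) = complex_of_real (1 + (\<Sum>X\<in>\<P>. measure lebesgue X))"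
    using ft\<Omega>[of 0] by (simp add: ft_zero \<Omega> lm measure_unit_cube)
  moreover have "0 < (\<Sum>X\<in>\<P>. measure lebesgue X)"
    using \<P> poly(2) by (intro sum_pos)
  ultimately show False unfolding of_real_eq_iff by linarith
qed

end
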